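(* Let $\varphi$ be holomorphic on $\mathbb D^2$, let $r\geq1$, let $F=(f_1,\ldots,f_r)\in\mathcal D_\infty(\varphi)^r$, and set $$\mathcal M=\overline{\operatorname{span}}\{\varphi^nf_j:n\geq0,\ 1\leq j\leq r\}$$ (closure in $H^2(\mathbb D^2)$). For positive integers $M,N$ put $\mathcal M_{M,N}=\pi_{M,N}(\mathcal M)\subseteq\mathcal A_{M,N}$ and $U=\pi_{M,N}\varphi-\varphi(0)1\in\mathcal A_{M,N}$. Then, for all positive integers $M,N$, $$\operatorname{codim}_{\mathcal A_{M,N}}\mathcal M_{M,N}\ \geq\ MN-r\,\nu(U)\ \geq\ MN-r(M+N-1).$$ In particular, $\mathcal M$ has infinite codimension in $H^2(\mathbb D^2)$.
   Context: $\mathbb D\subset\mathbb C$ is the open unit disk. The Hardy space $H^2(\mathbb D^2)$ is the Hilbert space of holomorphic functions $f(z)=\sum_{i,j\ge0}a_{ij}z_1^iz_2^j$ on $\mathbb D^2$ with $\|f\|^2=\sum_{i,j}|a_{ij}|^2<\infty$. For $\varphi$ holomorphic on $\mathbb D^2$, $\mathcal D_\infty(\varphi)=\{f\in H^2(\mathbb D^2):\varphi^nf\in H^2(\mathbb D^2)\text{ for every integer }n\geq0\}$. For positive integers $M,N$, $\mathcal A_{M,N}=\mathbb C[x,y]/(x^M,y^N)$, a commutative algebra of complex dimension $MN$ with basis $x^iy^j$, $0\le i<M$, $0\le j<N$, and identity $1$. For a function $g(z)=\sum_{i,j\geq0}a_{ij}z_1^iz_2^j$ holomorphic on $\mathbb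 D^2$, the rectangular Taylor truncation is $\pi_{M,N}(g)=\sum_{i<M,\,j<N}a_{ij}x^iy^j\in\mathcal A_{M,N}$. For an element $U\in\mathcal A_{M,N}$ with zero constant coefficient (which is necessarily nilpotent), $\nu(U)$ denotes the smallest positive integer $\nu$ with $U^\nu=0$; in particular $\nu(0)=1$. $\operatorname{codim}_{\mathcal A_{M,N}}$ denotes the codimension of a complex linear subspace of $\mathcal A_{M,N}$. *)

theory Defs
  imports
    "HOL-Complex_Analysis.Complex_Analysis"
    "HOL-Algebra.QuotRing"
    "Jordan_Normal_Form.VS_Connect"
begin

section \<open>Holomorphic functions on the bidisc\<close>

definition bidisc :: "(complex \<times> complex) set" where
  "bidisc = ball 0 1 \<times> ball 0 1"

text \<open>Complex Frechet differentiability at every point of the (open) bidisc.\<close>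
definition holomorphic_bidisc :: "(complex \<times> complex \<Rightarrow> complex) \<Rightarrow> bool" where
  "holomorphic_bidisc f \<longleftrightarrow>
     (\<forall>z\<in>bidisc. \<exists>a b. (f has_derivative (\<lambda>h. a * fst h + b * snd h)) (at z))"

text \<open>The coefficient of $z_1^i z_2^j$ in the Taylor series at the origin, that is
  $\partial_1^i \partial_2^j f(0,0) / (i!\, j!)$.\<close>
definition taylor_coeff :: "(complex \<times> complex \<Rightarrow> complex) \<Rightarrow> nat \<Rightarrow> nat \<Rightarrow> complex" where
  "taylor_coeff f i j =
     (deriv ^^ i) (\<lambda>z1. (deriv ^^ j) (\<lambda>z2. f (z1, z2)) 0) 0 / (fact i * fact j)"


section \<open>Complex vector spaces and codimension\<close>

text \<open>The quotient of a vector space (a HOL-Algebra module record) by a subspace \<open>W\<close>. Adding \<open>W\<close>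
  in the scalar multiplication is only needed for \<open>c = 0\<close>, where the image of a coset
  is just the singleton of the zero vector. The \<open>mult\<close> and \<open>one\<close> fields of the record play no role for
  vector spaces.\<close>
definition quot_space ::
  "('k, 'v, 'm) module_scheme \<Rightarrow> 'v set \<Rightarrow> ('k, 'v set) module" where
  "quot_space V W =
     \<lparr>carrier = a_rcosets\<^bsub>V\<^esub> W, mult = undefined, one = undefined,
      zero = W, add = set_add V,
      smult = (\<lambda>c X. W <+>\<^bsub>V\<^esub> (\<lambda>x. c \<odot>\<^bsub>V\<^esub> x) ` X)\<rparr>"

lemma quot_space_vectorspace:
  assumes "vectorspace K V" "Module.submodule W K V"
  shows "vectorspace K (quot_space V W)"
proof -
  interpret vectorspace K V by fact
  interpret W: Module.submodule W K V by fact
  have WV: "W \<subseteq> carrier V" using W.subset by simp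
  have sub: "additive_subgroup W V" 
    by (rule additive_subgroup.intro) (rule W.subgroup_axioms)
  interpret S: abelian_subgroup W V
    by (rule abelian_subgroupI3[OF sub M.abelian_group_axioms])
  have sm: "W <+>\<^bsub>V\<^esub> (\<lambda>x. c \<odot>\<^bsub>V\<^esub> x) ` (W +>\<^bsub>V\<^esub> v) = W +>\<^bsub>V\<^esub> (c \<odot>\<^bsub>V\<^esub> v)"
    if c: "c \<in> carrier K" and v: "v \<in> carrier V" for c v
  proof (intro equalityI subsetI)
    fix y assume "y \<in> W <+>\<^bsub>V\<^esub> (\<lambda>x. c \<odot>\<^bsub>V\<^esub> x) ` (W +>\<^bsub>V\<^esub> v)"
    then obtain w w' where w: "w \<in> W" "w' \<in> W" and y: "y = w \<oplus>\<^bsub>V\<^esub> c \<odot>\<^bsub>V\<^esub> (w' \<oplus>\<^bsub>V\<^esub> v)"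
      unfolding set_add_def' a_r_coset_def' by auto
    have [simp]: "w \<in> carrier V" "w' \<in> carrier V" using w WV by auto
    have "y = (w \<oplus>\<^bsub>V\<^esub> c \<odot>\<^bsub>V\<^esub> w') \<oplus>\<^bsub>V\<^esub> c \<odot>\<^bsub>V\<^esub> v"
      using c v y by (simp add: smult_r_distr M.a_assoc)
    moreover have "w \<oplus>\<^bsub>V\<^esub> c \<odot>\<^bsub>V\<^esub> w' \<in> W" using w c W.smult_closed S.a_closed by simp
    ultimately show "y \<in> W +>\<^bsub>V\<^esub> (c \<odot>\<^bsub>V\<^esub> v)" unfolding a_r_coset_def' by auto
  next
    fix y assume "y \<in> W +>\<^bsub>V\<^esub> (c \<odot>\<^bsub>V\<^esub> v)"
    then obtain w where w: "w \<in> W" and y: "y = w \<oplus>\<^bsub>V\<^esub> c \<odot>\<^bsub>V\<^esub> v"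
      unfolding a_r_coset_def' by auto
    have "v \<in> W +>\<^bsub>V\<^esub> v" using v by (simp add: S.a_rcos_self)
    with w y show "y \<in> W <+>\<^bsub>V\<^esub> (\<lambda>x. c \<odot>\<^bsub>V\<^esub> x) ` (W +>\<^bsub>V\<^esub> v)"
      unfolding set_add_def' by auto
  qed
  have car: "X \<in> carrier (quot_space V W) \<longleftrightarrow> (\<exists>v\<in>carrier V. X = W +>\<^bsub>V\<^esub> v)" for X
    by (auto simp: quot_space_def A_RCOSETS_def')
  have add: "(W +>\<^bsub>V\<^esub> v) \<oplus>\<^bsub>quot_space V W\<^esub> (W +>\<^bsub>V\<^esub> w) = W +>\<^bsub>V\<^esub> (v \<oplus>\<^bsub>V\<^esub> w)"
    if "v \<in> carrier V" "w \<in> carrier V" for v w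
    using that by (simp add: quot_space_def S.a_rcos_sum)
  have zero: "\<zero>\<^bsub>quot_space V W\<^esub> = W +>\<^bsub>V\<^esub> \<zero>\<^bsub>V\<^esub>"
    using WV by (simp add: quot_space_def M.a_coset_add_zero)
  have smu: "c \<odot>\<^bsub>quot_space V W\<^esub> (W +>\<^bsub>V\<^esub> v) = W +>\<^bsub>V\<^esub> (c \<odot>\<^bsub>V\<^esub> v)"
    if "c \<in> carrier K" "v \<in> carrier V" for c v
    using sm[OF that] by (simp add: quot_space_def)
  have ab: "abelian_group (quot_space V W)"
  proof (rule abelian_groupI)
    fix x assume "x \<in> carrier (quot_space V W)"
    then obtain v where v: "v \<in> carrier V" "x = W +>\<^bsub>V\<^esub> v" by (auto simp: car)
    show "\<exists>y\<in>carrier (quot_space V W). y \<oplus>\<^bsub>quot_space V W\<^esub> x = \<zero>\<^bsub>quot_space V W\<^esub>"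
      using v by (intro bexI[of _ "W +>\<^bsub>V\<^esub> (\<ominus>\<^bsub>V\<^esub> v)"]) (auto simp: car add zero M.l_neg intro!: bexI[of _ "\<ominus>\<^bsub>V\<^esub> v"])
  qed (force simp: car add zero M.a_ac)+
  have "module K (quot_space V W)"
    by (rule moduleI[OF R.is_cring ab])
       (auto simp: car add smu smult_l_distr smult_r_distr smult_assoc1)
  then show ?thesis by (intro vectorspace.intro) (simp_all add: field_axioms)
qed

definition finite_codim :: "(complex, 'v, 'm) module_scheme \<Rightarrow> 'v set \<Rightarrow> bool" where
  "finite_codim V W \<longleftrightarrow> vectorspace.fin_dim class_ring (quot_space V W)"

text \<open>As for \<^const>\<open>vectorspace.dim\<close>, the value is only meaningful if
  \<^const>\<open>finite_codim\<close> holds.\<close>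
definition codim :: "(complex, 'v, 'm) module_scheme \<Rightarrow> 'v set \<Rightarrow> nat" where
  "codim V W = vectorspace.dim class_ring (quot_space V W)"


section \<open>The Hardy space of the bidisc\<close>

text \<open>A function on the bidisc is represented by its extension by zero, so that distinct elements
  of the set differ at a point of the bidisc.\<close>
definition hardy2 :: "(complex \<times> complex \<Rightarrow> complex) set" where
  "hardy2 = {f. holomorphic_bidisc f \<and> (\<forall>z. z \<notin> bidisc \<longrightarrow> f z = 0) \<and>
     (\<lambda>(i, j). (cmod (taylor_coeff f i j))\<^sup>2) summable_on UNIV}"

definition hardy2_norm :: "(complex \<times> complex \<Rightarrow> complex) \<Rightarrow> real" where
  "hardy2_norm f = sqrt (\<Sum>\<^sub>\<infinity>(i, j)\<in>UNIV. (cmod (taylor_coeff f i j))\<^sup>2)"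

definition hardy2_space :: "(complex, complex \<times> complex \<Rightarrow> complex) module" where
  "hardy2_space =
     \<lparr>carrier = hardy2, mult = undefined, one = undefined,
      zero = (\<lambda>_. 0), add = (\<lambda>f g z. f z + g z), smult = (\<lambda>c f z. c * f z)\<rparr>"

definition hardy2_closure ::
  "(complex \<times> complex \<Rightarrow> complex) set \<Rightarrow> (complex \<times> complex \<Rightarrow> complex) set" where
  "hardy2_closure S = {f \<in> hardy2. \<forall>e>0. \<exists>g\<in>S. hardy2_norm (\<lambda>z. f z - g z) < e}"

definition D_infty :: "(complex \<times> complex \<Rightarrow> complex) \<Rightarrow> (complex \<times> complex \<Rightarrow> complex) set" where
  "D_infty \<phi> = {f \<in> hardy2. \<forall>n. (\<lambda>z. \<phi> z ^ n * f z) \<in> hardy2}"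

text \<open>The closed span of all $\varphi^n f_j$ with $n \geq 0$ and $1 \leq j \leq r$.\<close>
definition orbit_space ::
  "(complex \<times> complex \<Rightarrow> complex) \<Rightarrow> nat \<Rightarrow> (nat \<Rightarrow> complex \<times> complex \<Rightarrow> complex)
     \<Rightarrow> (complex \<times> complex \<Rightarrow> complex) set" where
  "orbit_space \<phi> r f =
     hardy2_closure (LinearCombinations.module.span class_ring hardy2_space
       {(\<lambda>z. \<phi> z ^ n * f j z) | n j. j \<in> {1..r}})"


section \<open>The truncated polynomial algebras\<close>

text \<open>$\mathbb{C}[x,y]$ is represented as $(\mathbb{C}[x])[y]$, so that $x^i y^j$ with
  coefficient \<open>c\<close> is \<open>monom (monom c i) j\<close>.\<close>
abbreviation bipoly_ring :: "complex poly poly ring" where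
  "bipoly_ring \<equiv> class_ring"

definition trunc_ideal :: "nat \<Rightarrow> nat \<Rightarrow> complex poly poly set" where
  "trunc_ideal M N = genideal bipoly_ring {monom (monom 1 M) 0, monom (monom 1 0) N}"

text \<open>The quotient ring $\mathbb{C}[x,y]/(x^M,y^N)$ with its structure of a complex algebra,
  in which \<open>c\<close> acts as multiplication by the class of the constant polynomial \<open>c\<close>.\<close>
definition trunc_alg :: "nat \<Rightarrow> nat \<Rightarrow> (complex, complex poly poly set) module" where
  "trunc_alg M N = (let Q = bipoly_ring Quot trunc_ideal M N in
     \<lparr>carrier = carrier Q, mult = mult Q, one = one Q, zero = zero Q, add = add Q,
      smult = (\<lambda>c X. (trunc_ideal M N +>\<^bsub>bipoly_ring\<^esub> monom (monom c 0) 0) \<otimes>\<^bsub>Q\<^esub> X)\<rparr>)"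

lemma trunc_alg_algebra: "algebra (class_ring :: complex ring) (trunc_alg M N)"
proof -
  let ?R = bipoly_ring
  interpret R: cring ?R by (rule class_cring.cring_axioms)
  interpret I: ideal "trunc_ideal M N" ?R unfolding trunc_ideal_def by (rule ring.genideal_ideal[OF class_ring.ring_axioms]) auto
  let ?Q = "?R Quot trunc_ideal M N"
  interpret Q: cring ?Q by (rule I.quotient_is_cring) (rule class_cring.cring_axioms)
  interpret h: ring_hom_ring ?R ?Q "(+>\<^bsub>?R\<^esub>) (trunc_ideal M N)" by (rule I.rcos_ring_hom_ring)
  let ?A = "trunc_alg M N"
  have A: "carrier ?A = carrier ?Q" "mult ?A = mult ?Q" "one ?A = one ?Q" "zero ?A = zero ?Q" "add ?A = add ?Q"
    "smult ?A = (\<lambda>c X. (trunc_ideal M N +>\<^bsub>?R\<^esub> monom (monom c 0) 0) \<otimes>\<^bsub>?Q\<^esub> X)"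
    by (simp_all add: trunc_alg_def Let_def)
  have cl: "trunc_ideal M N +>\<^bsub>?R\<^esub> p \<in> carrier ?Q" for p using h.hom_closed[of p] by simp
  have ab: "abelian_group ?A"
    by (rule abelian_groupI) (auto simp: A Q.a_ac intro: Q.l_neg[rotated] bexI[of _ "\<ominus>\<^bsub>?Q\<^esub> _"])
  have cm: "comm_monoid ?A" by (rule comm_monoidI) (auto simp: A Q.m_ac)
  have cA: "cring ?A"
    by (rule cringI[OF ab cm]) (auto simp: A Q.l_distr)
  have cC: "cring (class_ring :: complex ring)"
    by (rule class_cring.cring_axioms)
  show ?thesis
  proof (rule algebraI[OF cC cA], goal_cases)
    case (2 a b x)
    have "monom (monom (a + b) 0) 0 = (monom (monom a 0) 0 + monom (monom b 0) 0 :: complex poly poly)" by (simp add: add_monom)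
    with 2 show ?case using h.hom_add[of "monom (monom a 0) 0" "monom (monom b 0) 0"] 
       by (simp add: A Q.l_distr cl)
  next
    case (4 a b x)
    have "monom (monom (a * b) 0) 0 = (monom (monom a 0) 0 * monom (monom b 0) 0 :: complex poly poly)" by (simp add: mult_monom)
    with 4 show ?case using h.hom_mult[of "monom (monom a 0) 0" "monom (monom b 0) 0"] 
       by (simp add: A Q.m_assoc cl)
  next
    case (5 x)
    have "monom (monom 1 0) 0 = (1 :: complex poly poly)" by (simp add: monom_0 one_pCons)
    with 5 show ?case using h.hom_one by (simp add: A)
  qed (auto simp: A cl Q.r_distr Q.m_assoc)
qed

definition taylor_trunc ::
  "nat \<Rightarrow> nat \<Rightarrow> (complex \<times> complex \<Rightarrow> complex) \<Rightarrow> complex poly poly set" where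
  "taylor_trunc M N g = trunc_ideal M N +>\<^bsub>bipoly_ring\<^esub>
     (\<Sum>i<M. \<Sum>j<N. monom (monom (taylor_coeff g i j) i) j)"

text \<open>The least positive exponent annihilating a nilpotent element \<open>U\<close>.\<close>
definition nilpotency_index :: "('a, 'm) ring_scheme \<Rightarrow> 'a \<Rightarrow> nat" where
  "nilpotency_index R U = (LEAST n. 0 < n \<and> U [^]\<^bsub>R\<^esub> n = \<zero>\<^bsub>R\<^esub>)"

end

theory Submission
  imports Defs
begin

text \<open>Fix \<open>M\<close> and \<open>N\<close>, and let \<open>\<pi>\<close> be the truncation of Taylor series modulo \<open>(x\<^sup>M, y\<^sup>N)\<close>. By the
  Cauchy product formula (\<open>taylor_coeff_mult\<close>), \<open>\<pi>\<close> is multiplicative, so that the image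
  of \<open>\<phi>\<^sup>n f\<^sub>j\<close> is \<open>(U + \<phi>(0))\<^sup>n \<pi>(f\<^sub>j)\<close>. As \<open>U\<close> is nilpotent of index \<open>\<nu>\<close>, all these images lie in the span of
  the \<open>r\<nu>\<close> elements \<open>U\<^sup>k \<pi>(f\<^sub>j)\<close> with \<open>k < \<nu>\<close> and \<open>1 \<le> j \<le> r\<close>. Passing to the closure of the span of the orbit does not
  enlarge this bound: the Taylor coefficients are continuous for the Hardy norm, and a subspace of a
  finite-dimensional space is closed (\<open>taylor_poly_orbit_space\<close>). Hence \<open>\<pi>\<close> maps the orbit space into a
  space of dimension at most \<open>r\<nu>\<close>, while the whole algebra has dimension \<open>MN\<close>. This is the first
  inequality.

  For the second one, \<open>U\<close> has no constant term, so \<open>U\<close> to the power \<open>M + N - 1\<close> only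
  involves monomials of total degree at least \<open>M + N - 1\<close>, and each of them is divisible by \<open>x\<^sup>M\<close> or by
  \<open>y\<^sup>N\<close> (\<open>power_vanishing_order\<close>). Therefore \<open>\<nu> \<le> M + N - 1\<close>.

  Finally \<open>\<pi>\<close> maps the Hardy space onto the truncated algebra, since monomials are in the Hardy space. If the orbit
  space had finite codimension \<open>d\<close>, then \<open>N\<^sup>2 \<le> r(2N - 1) + d\<close> would hold for every \<open>N\<close>, which is
  absurd for large \<open>N\<close>.

  Both lower bounds on a codimension are instances of one statement, \<open>card_le_codim\<close>. It uses
  polynomials as a common target: classes in the truncated algebra are represented by their normal
  form, a polynomial of degree below \<open>M\<close> in \<open>x\<close> and below \<open>N\<close> in \<open>y\<close>.\<close>

section \<open>Taylor coefficients on the bidisc\<close>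

lemma holomorphic_bidisc_slices:
  assumes "holomorphic_bidisc f"
  shows "w \<in> ball 0 1 \<Longrightarrow> (\<lambda>z. f (z, w)) holomorphic_on ball 0 1"
    and "z \<in> ball 0 1 \<Longrightarrow> (\<lambda>w. f (z, w)) holomorphic_on ball 0 1"
proof -
  have "(\<lambda>z. f (z, w)) field_differentiable at z \<and> (\<lambda>w. f (z, w)) field_differentiable at w"
    if zw: "z \<in> ball 0 1" "w \<in> ball 0 1" for z w
  proof -
    have "(z, w) \<in> bidisc" using zw by (simp add: bidisc_def)
    then obtain a b where D: "(f has_derivative (\<lambda>h. a * fst h + b * snd h)) (at (z, w))"
      using assms unfolding holomorphic_bidisc_def by blast
    have "((\<lambda>z. (z, w)) has_derivative (\<lambda>h. (h, 0))) (at z)"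
      by (auto intro!: derivative_eq_intros)
    from has_derivative_compose[OF this D] have 1: "((\<lambda>z. f (z, w)) has_derivative (\<lambda>h. a * h)) (at z)"
      by simp
    have "((\<lambda>w. (z, w)) has_derivative (\<lambda>h. (0, h))) (at w)"
      by (auto intro!: derivative_eq_intros)
    from has_derivative_compose[OF this D] have 2: "((\<lambda>w. f (z, w)) has_derivative (\<lambda>h. b * h)) (at w)"
      by simp
    show ?thesis using 1 2 unfolding field_differentiable_def has_field_derivative_def by blast
  qed
  then show "w \<in> ball 0 1 \<Longrightarrow> (\<lambda>z. f (z, w)) holomorphic_on ball 0 1"
    and "z \<in> ball 0 1 \<Longrightarrow> (\<lambda>w. f (z, w)) holomorphic_on ball 0 1"
    by (auto simp: holomorphic_on_def intro: field_differentiable_at_within)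
qed

lemma holomorphic_bidisc_continuous:
  assumes "holomorphic_bidisc f"
  shows "continuous_on bidisc f"
  using assms unfolding holomorphic_bidisc_def
  by (meson continuous_at_imp_continuous_on has_derivative_continuous)

text \<open>Cauchy's formula on a circle of fixed radius, written as an integral over \<open>{0..1}\<close> so that the
  results on parametric integrals apply. Parameters enter through \<open>x\<close> as well as through \<open>g\<close>.\<close>

lemma higher_deriv_circle_integral:
  assumes "g holomorphic_on ball 0 1" "0 < r" "r < 1" "x \<in> ball 0 r"
  shows "(deriv ^^ k) g x = fact k / (2 * pi * \<i>) *
    integral {0..1} (\<lambda>t. g (circlepath 0 r t) / (circlepath 0 r t - x) ^ Suc k
                       * (2 * pi * \<i> * r * exp (2 * of_real pi * \<i> * t)))"
proof -
  have sub: "cball 0 r \<subseteq> ball (0::complex) 1" using assms by auto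
  have "((\<lambda>u. g u / (u - x) ^ Suc k) has_contour_integral
          (2 * pi * \<i>) / fact k * (deriv ^^ k) g x) (circlepath 0 r)"
    using assms sub by (intro Cauchy_has_contour_integral_higher_derivative_circlepath)
      (auto intro: holomorphic_on_subset holomorphic_on_imp_continuous_on)
  then have "contour_integral (circlepath 0 r) (\<lambda>u. g u / (u - x) ^ Suc k)
     = (2 * pi * \<i>) / fact k * (deriv ^^ k) g x"
    by (rule contour_integral_unique)
  then show ?thesis
    by (simp add: contour_integral_integral vector_derivative_circlepath)
qed

lemma continuous_on_circlepath: "continuous_on S (circlepath z r)"
  unfolding circlepath by (intro continuous_intros)

lemma circlepath_0_norm: "0 \<le> r \<Longrightarrow> norm (circlepath 0 r t) = r"
  by (simp add: circlepath norm_mult)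

text \<open>Complex differentiability at each point does not give continuous partial derivatives by itself;
  Cauchy's formula expresses the derivative in \<open>z\<close> as an integral whose integrand is jointly
  continuous in \<open>z\<close>, \<open>w\<close> and the integration variable. The continuity justifies differentiation
  under the integral sign.\<close>

lemma continuous_on_partial_deriv:
  assumes f: "holomorphic_bidisc f" and r: "0 < r" "r < 1"
  shows "continuous_on (ball 0 r \<times> ball 0 1) (\<lambda>(z, w). deriv (\<lambda>u. f (u, w)) z)"
proof -
  let ?c = "circlepath 0 r"
  define K where "K = (\<lambda>(p :: complex \<times> complex) (t :: real). f (?c t, snd p) / (?c t - fst p) ^ Suc 1
                       * (2 * pi * \<i> * r * exp (2 * of_real pi * \<i> * t)))"
  have 1: "continuous_on ((ball 0 r \<times> ball 0 1) \<times> cbox 0 1) (\<lambda>(p, t). K p t)"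
    unfolding K_def split_def
  proof (intro continuous_intros)
    show "continuous_on ((ball 0 r \<times> ball 0 1) \<times> cbox 0 1)
        (\<lambda>x. f (?c (snd x), snd (fst x)))"
      using r by (intro continuous_on_compose2[OF holomorphic_bidisc_continuous[OF f]] continuous_intros
        continuous_on_compose2[OF continuous_on_circlepath])
        (auto simp: bidisc_def circlepath_0_norm)
    show "continuous_on ((ball 0 r \<times> ball (0::complex) 1) \<times> cbox 0 1) (\<lambda>x. ?c (snd x))"
      by (intro continuous_on_compose2[OF continuous_on_circlepath] continuous_intros) auto
    show "\<forall>x\<in>(ball 0 r \<times> ball (0::complex) 1) \<times> cbox 0 1. (?c (snd x) - fst (fst x)) ^ Suc 1 \<noteq> 0"
    proof
      fix x assume "x \<in> (ball (0::complex) r \<times> ball (0::complex) 1) \<times> cbox (0::real) 1"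
      then have "norm (fst (fst x)) < r" by auto
      moreover have "norm (?c (snd x)) = r" using r by (simp add: circlepath_0_norm)
      ultimately have "?c (snd x) \<noteq> fst (fst x)" by auto
      then show "(?c (snd x) - fst (fst x)) ^ Suc 1 \<noteq> 0" by simp
    qed
  qed
  have "continuous_on (ball 0 r \<times> ball 0 1) (\<lambda>p. 1 / (2 * pi * \<i>) * integral (cbox 0 1) (K p))"
    by (intro continuous_intros integral_continuous_on_param[OF 1])
  then show ?thesis
  proof (rule continuous_on_cong[THEN iffD1, rotated -1, OF _ refl])
    fix p :: "complex \<times> complex" assume "p \<in> ball 0 r \<times> ball 0 1"
    then show "1 / (2 * pi * \<i>) * integral (cbox 0 1) (K p) = (case p of (z, w) \<Rightarrow> deriv (\<lambda>u. f (u, w)) z)"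
      using higher_deriv_circle_integral[OF holomorphic_bidisc_slices(1)[OF f] r, of "snd p" "fst p" 1]
      by (auto simp: K_def split_def)
  qed
qed

text \<open>The derivatives in the second variable at \<open>0\<close> are Cauchy integrals over a circle, and these can be
  differentiated in the first variable under the integral sign. This makes the iterated derivatives
  in the definition of Taylor coefficients well behaved. A radius below \<open>1\<close> is
  enough, as only derivatives at the origin are taken afterwards.\<close>

lemma holomorphic_slice_higher_deriv:
  assumes f: "holomorphic_bidisc f"
  shows "(\<lambda>z. (deriv ^^ j) (\<lambda>w. f (z, w)) 0) holomorphic_on ball 0 (1/2)"
proof -
  let ?c = "circlepath 0 (1/2)"
  define k where "k = (\<lambda>t::real. 1 / ?c t ^ Suc j * (2 * pi * \<i> * (1/2) * exp (2 * of_real pi * \<i> * t)))"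
  have c0: "?c t \<noteq> 0" for t by (simp add: circlepath)
  have ck: "continuous_on S k" for S
    unfolding k_def by (intro continuous_intros continuous_on_circlepath) (auto simp: c0)
  have cin: "?c t \<in> ball 0 1" for t by (simp add: circlepath_0_norm)
  have "(\<lambda>z. integral (cbox 0 1) (\<lambda>t. f (z, ?c t) * k t)) holomorphic_on ball 0 (1/2)"
  proof (rule leibniz_rule_holomorphic)
    fix z t assume z: "z \<in> ball (0::complex) (1/2)" and "t \<in> cbox (0::real) 1"
    have "((\<lambda>z. f (z, ?c t)) has_field_derivative deriv (\<lambda>u. f (u, ?c t)) z) (at z)"
      using z by (intro holomorphic_derivI[OF holomorphic_bidisc_slices(1)[OF f cin]]) auto
    then show "((\<lambda>z. f (z, ?c t) * k t) has_field_derivative deriv (\<lambda>u. f (u, ?c t)) z * k t)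
                 (at z within ball 0 (1/2))"
      by (intro DERIV_cmult_right) (rule has_field_derivative_at_within)
  next
    fix z assume z: "z \<in> ball (0::complex) (1/2)"
    have "continuous_on (cbox 0 1) (\<lambda>t. f (z, ?c t) * k t)"
      using z by (intro continuous_intros ck continuous_on_circlepath
         continuous_on_compose2[OF holomorphic_bidisc_continuous[OF f]])
         (auto simp: bidisc_def circlepath_0_norm)
    then show "(\<lambda>t. f (z, ?c t) * k t) integrable_on cbox 0 1" by (rule integrable_continuous)
  next
    show "continuous_on (ball 0 (1/2) \<times> cbox 0 1) (\<lambda>(z, t). deriv (\<lambda>u. f (u, ?c t)) z * k t)"
      unfolding split_def
    proof (intro continuous_on_mult)
      show "continuous_on (ball 0 (1/2) \<times> cbox 0 1) (\<lambda>x. deriv (\<lambda>u. f (u, ?c (snd x))) (fst x))"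
      proof -
        have "continuous_on (ball 0 (1/2) \<times> cbox 0 1) (\<lambda>x::complex \<times> real. (fst x, ?c (snd x)))"
          by (intro continuous_on_Pair continuous_on_compose2[OF continuous_on_circlepath[of UNIV]] continuous_intros) auto
        moreover have "(\<lambda>x. (fst x, ?c (snd x))) ` (ball 0 (1/2) \<times> cbox 0 1) \<subseteq> ball 0 (1/2) \<times> ball 0 1"
          using cin by auto
        ultimately show ?thesis
          using continuous_on_compose2[OF continuous_on_partial_deriv[OF f, of "1/2"]] by (fastforce simp: split_def)
      qed
      show "continuous_on (ball 0 (1/2) \<times> cbox 0 1) (\<lambda>x::complex \<times> real. k (snd x))"
        by (intro continuous_on_compose2[OF ck[of UNIV]] continuous_intros) auto
    qed
  qed auto
  then have "(\<lambda>z. fact j / (2 * pi * \<i>) * integral (cbox 0 1) (\<lambda>t. f (z, ?c t) * k t))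
     holomorphic_on ball 0 (1/2)" by (intro holomorphic_intros)
  then show ?thesis
  proof (rule holomorphic_transform)
    fix z :: complex assume "z \<in> ball 0 (1/2)"
    then show "fact j / (2 * pi * \<i>) * integral (cbox 0 1) (\<lambda>t. f (z, ?c t) * k t) =
        (deriv ^^ j) (\<lambda>w. f (z, w)) 0"
      using higher_deriv_circle_integral[OF holomorphic_bidisc_slices(2)[OF f], of z "1/2" 0 j]
      by (simp add: k_def mult_ac)
  qed
qed

text \<open>The double Taylor series is organised as an iterated one: first the power series in the second variable
  for fixed \<open>z\<close>, then, for each of its coefficients, the power series in \<open>z\<close>. In this way the
  rules for expansions in one variable give those in two variables.\<close>

definition slice_series :: "(complex \<times> complex \<Rightarrow> complex) \<Rightarrow> complex \<Rightarrow> complex fps" where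
  "slice_series f z = fps_expansion (\<lambda>w. f (z, w)) 0"

definition taylor_row :: "(complex \<times> complex \<Rightarrow> complex) \<Rightarrow> nat \<Rightarrow> complex fps" where
  "taylor_row f j = fps_expansion (\<lambda>z. fps_nth (slice_series f z) j) 0"

lemma slice_series:
  assumes "holomorphic_bidisc f" "z \<in> ball 0 1"
  shows "(\<lambda>w. f (z, w)) has_fps_expansion slice_series f z"
  unfolding slice_series_def
  using holomorphic_bidisc_slices(2)[OF assms]
  by (intro analytic_at_imp_has_fps_expansion_0) (auto simp: analytic_at intro!: exI[of _ "ball 0 1"])

lemma taylor_row:
  assumes "holomorphic_bidisc f"
  shows "(\<lambda>z. fps_nth (slice_series f z) j) has_fps_expansion taylor_row f j"
proof -
  have "(\<lambda>z. (deriv ^^ j) (\<lambda>w. f (z, w)) 0 / fact j) holomorphic_on ball 0 (1/2)"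
    by (intro holomorphic_intros holomorphic_slice_higher_deriv assms) simp
  then show ?thesis
    unfolding taylor_row_def
    by (intro analytic_at_imp_has_fps_expansion_0)
      (auto simp: analytic_at slice_series_def fps_expansion_def intro!: exI[of _ "ball 0 (1/2)"])
qed

lemma taylor_coeff_eq_row:
  assumes "holomorphic_bidisc f"
  shows "taylor_coeff f i j = fps_nth (taylor_row f j) i"
proof -
  have "(deriv ^^ i) (\<lambda>z. 1 / fact j * (deriv ^^ j) (\<lambda>w. f (z, w)) 0) 0
      = 1 / fact j * (deriv ^^ i) (\<lambda>z. (deriv ^^ j) (\<lambda>w. f (z, w)) 0) 0"
    by (rule higher_deriv_cmult[OF holomorphic_slice_higher_deriv[OF assms]]) auto
  then show ?thesis
    by (simp add: taylor_coeff_def taylor_row_def slice_series_def fps_expansion_def)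
qed

text \<open>Reduces an identity between Taylor coefficients to expansions in one variable, of \<open>f (z, w)\<close> in \<open>w\<close> and
  of its coefficients in \<open>z\<close>; uniqueness of expansions does the rest.\<close>

lemma taylor_row_eqI:
  assumes "\<And>z. z \<in> ball 0 1 \<Longrightarrow> (\<lambda>w. f (z, w)) has_fps_expansion F z"
    and "(\<lambda>z. fps_nth (F z) j) has_fps_expansion G"
  shows "taylor_row f j = G"
proof -
  have "eventually (\<lambda>z. z \<in> ball 0 1) (nhds (0::complex))"
    by (intro eventually_nhds_in_open) auto
  then have "eventually (\<lambda>z. fps_nth (slice_series f z) j = fps_nth (F z) j) (nhds 0)"
    by eventually_elim (simp add: slice_series_def fps_expansion_eqI[OF assms(1)])
  then have "(\<lambda>z. fps_nth (slice_series f z) j) has_fps_expansion G"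
    using has_fps_expansion_cong[OF _ refl, THEN iffD2, OF _ assms(2)] by simp
  then show ?thesis unfolding taylor_row_def by (rule fps_expansion_eqI)
qed

lemma holomorphic_bidisc_add:
  assumes "holomorphic_bidisc f" "holomorphic_bidisc g"
  shows "holomorphic_bidisc (\<lambda>z. f z + g z)"
  unfolding holomorphic_bidisc_def
proof
  fix z assume z: "z \<in> bidisc"
  obtain a b where f: "(f has_derivative (\<lambda>h. a * fst h + b * snd h)) (at z)"
    using assms(1) z unfolding holomorphic_bidisc_def by blast
  obtain c d where g: "(g has_derivative (\<lambda>h. c * fst h + d * snd h)) (at z)"
    using assms(2) z unfolding holomorphic_bidisc_def by blast
  from has_derivative_add[OF f g]
  have "((\<lambda>z. f z + g z) has_derivative (\<lambda>h. (a + c) * fst h + (b + d) * snd h)) (at z)"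
    by (simp add: algebra_simps)
  then show "\<exists>a b. ((\<lambda>z. f z + g z) has_derivative (\<lambda>h. a * fst h + b * snd h)) (at z)" by blast
qed

lemma holomorphic_bidisc_mult:
  assumes "holomorphic_bidisc f" "holomorphic_bidisc g"
  shows "holomorphic_bidisc (\<lambda>z. f z * g z)"
  unfolding holomorphic_bidisc_def
proof
  fix z assume z: "z \<in> bidisc"
  obtain a b where f: "(f has_derivative (\<lambda>h. a * fst h + b * snd h)) (at z)"
    using assms(1) z unfolding holomorphic_bidisc_def by blast
  obtain c d where g: "(g has_derivative (\<lambda>h. c * fst h + d * snd h)) (at z)"
    using assms(2) z unfolding holomorphic_bidisc_def by blast
  from has_derivative_mult[OF f g]
  have "((\<lambda>z. f z * g z) has_derivative
      (\<lambda>h. (f z * c + a * g z) * fst h + (f z * d + b * g z) * snd h)) (at z)"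
    by (simp add: algebra_simps)
  then show "\<exists>a b. ((\<lambda>z. f z * g z) has_derivative (\<lambda>h. a * fst h + b * snd h)) (at z)" by blast
qed

lemma holomorphic_bidisc_const: "holomorphic_bidisc (\<lambda>_. c)"
  unfolding holomorphic_bidisc_def
  by (intro ballI exI[of _ 0]) auto

lemma holomorphic_bidisc_fst: "holomorphic_bidisc fst"
  unfolding holomorphic_bidisc_def
  by (intro ballI exI[of _ 1] exI[of _ 0]) (auto intro!: derivative_eq_intros)

lemma holomorphic_bidisc_snd: "holomorphic_bidisc snd"
  unfolding holomorphic_bidisc_def
  by (intro ballI exI[of _ 1] exI[of _ 0]) (auto intro!: derivative_eq_intros)

lemma holomorphic_bidisc_power:
  "holomorphic_bidisc f \<Longrightarrow> holomorphic_bidisc (\<lambda>z. f z ^ n)"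
  by (induction n) (auto intro: holomorphic_bidisc_const holomorphic_bidisc_mult)

lemma open_bidisc: "open bidisc"
  unfolding bidisc_def by (intro open_Times open_ball)

lemma holomorphic_bidisc_transform:
  assumes "holomorphic_bidisc f" "\<And>z. z \<in> bidisc \<Longrightarrow> f z = g z"
  shows "holomorphic_bidisc g"
  using assms has_derivative_transform_within_open[OF _ open_bidisc]
  unfolding holomorphic_bidisc_def by metis

lemma taylor_coeff_transform:
  assumes "holomorphic_bidisc f" "\<And>z. z \<in> bidisc \<Longrightarrow> f z = g z"
  shows "taylor_coeff g i j = taylor_coeff f i j"
proof -
  have g: "holomorphic_bidisc g" using holomorphic_bidisc_transform[OF assms] .
  have "taylor_row g j = taylor_row f j"
  proof (rule taylor_row_eqI[where F = "slice_series f"])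
    fix z :: complex assume z: "z \<in> ball 0 1"
    have "eventually (\<lambda>w. w \<in> ball 0 1) (nhds (0::complex))"
      by (intro eventually_nhds_in_open) auto
    then have "eventually (\<lambda>w. g (z, w) = f (z, w)) (nhds 0)"
      by eventually_elim (use z in \<open>auto simp: bidisc_def assms(2)\<close>)
    then show "(\<lambda>w. g (z, w)) has_fps_expansion slice_series f z"
      using has_fps_expansion_cong[OF _ refl, THEN iffD2, OF _ slice_series[OF assms(1) z]] by simp
  qed (rule taylor_row[OF assms(1)])
  then show ?thesis by (simp add: taylor_coeff_eq_row assms(1) g)
qed

lemma taylor_coeff_add:
  assumes "holomorphic_bidisc f" "holomorphic_bidisc g"
  shows "taylor_coeff (\<lambda>z. f z + g z) i j = taylor_coeff f i j + taylor_coeff g i j"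
proof -
  have "taylor_row (\<lambda>z. f z + g z) j = taylor_row f j + taylor_row g j"
    by (rule taylor_row_eqI[where F = "\<lambda>z. slice_series f z + slice_series g z"])
      (use assms in \<open>auto intro!: fps_expansion_intros slice_series taylor_row\<close>)
  then show ?thesis by (simp add: taylor_coeff_eq_row holomorphic_bidisc_add assms)
qed

text \<open>The Cauchy product, applied in each variable in turn.\<close>

lemma taylor_coeff_mult:
  assumes "holomorphic_bidisc f" "holomorphic_bidisc g"
  shows "taylor_coeff (\<lambda>z. f z * g z) i j =
    (\<Sum>l\<le>j. \<Sum>k\<le>i. taylor_coeff f k l * taylor_coeff g (i - k) (j - l))"
proof -
  have "taylor_row (\<lambda>z. f z * g z) j = (\<Sum>l=0..j. taylor_row f l * taylor_row g (j - l))"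
    by (rule taylor_row_eqI[where F = "\<lambda>z. slice_series f z * slice_series g z"])
      (use assms in \<open>auto simp: fps_mult_nth intro!: fps_expansion_intros slice_series taylor_row\<close>)
  then show ?thesis
    by (simp add: taylor_coeff_eq_row holomorphic_bidisc_mult assms fps_sum_nth fps_mult_nth atLeast0AtMost)
qed

lemma taylor_coeff_0_0: "taylor_coeff f 0 0 = f (0, 0)"
  by (simp add: taylor_coeff_def)

lemma taylor_coeff_monomial:
  "taylor_coeff (\<lambda>z. fst z ^ a * snd z ^ b) i j = (if i = a \<and> j = b then 1 else 0)"
proof -
  have h: "holomorphic_bidisc (\<lambda>z. fst z ^ a * snd z ^ b)"
    by (intro holomorphic_bidisc_mult holomorphic_bidisc_power holomorphic_bidisc_fst holomorphic_bidisc_snd)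
  have "taylor_row (\<lambda>z. fst z ^ a * snd z ^ b) j = (if j = b then fps_X ^ a else 0)"
  proof (rule taylor_row_eqI[where F = "\<lambda>z. fps_const (z ^ a) * fps_X ^ b"])
    show "(\<lambda>w. fst (z, w) ^ a * snd (z, w) ^ b) has_fps_expansion fps_const (z ^ a) * fps_X ^ b" for z :: complex
      by (auto intro!: fps_expansion_intros)
    show "(\<lambda>z. fps_nth (fps_const (z ^ a) * fps_X ^ b) j) has_fps_expansion (if j = b then fps_X ^ a else 0 :: complex fps)"
      by (auto simp: fps_X_power_nth intro!: fps_expansion_intros)
  qed
  then show ?thesis by (simp add: taylor_coeff_eq_row[OF h] fps_X_power_nth)
qed

lemma taylor_coeff_const: "taylor_coeff (\<lambda>_. c) i j = (if i = 0 \<and> j = 0 then c else 0)"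
proof -
  have "(deriv ^^ i) (\<lambda>_. if j = 0 then c else 0) 0 = (if i = 0 \<and> j = 0 then c else (0::complex))"
    by (cases "j = 0") auto
  then show ?thesis by (simp add: taylor_coeff_def)
qed

lemma taylor_coeff_cmult:
  assumes "holomorphic_bidisc f"
  shows "taylor_coeff (\<lambda>z. c * f z) i j = c * taylor_coeff f i j"
proof -
  have "taylor_coeff (\<lambda>z. c * f z) i j =
     (\<Sum>l\<le>j. \<Sum>k\<le>i. if l = 0 then if k = 0 then c * taylor_coeff f (i - k) (j - l) else 0 else 0)"
    unfolding taylor_coeff_mult[OF holomorphic_bidisc_const assms] taylor_coeff_const
    by (intro sum.cong) auto
  also have "\<dots> = (\<Sum>l\<le>j. if l = 0 then (\<Sum>k\<le>i. if k = 0 then c * taylor_coeff f (i - k) (j - l) else 0) else 0)"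
    by (intro sum.cong) auto
  finally show ?thesis by simp
qed

lemma taylor_coeff_diff:
  assumes "holomorphic_bidisc f" "holomorphic_bidisc g"
  shows "taylor_coeff (\<lambda>z. f z - g z) i j = taylor_coeff f i j - taylor_coeff g i j"
proof -
  have "holomorphic_bidisc (\<lambda>z. (-1) * g z)"
    by (rule holomorphic_bidisc_mult[OF holomorphic_bidisc_const assms(2)])
  from taylor_coeff_add[OF assms(1) this, of i j] show ?thesis
    unfolding taylor_coeff_cmult[OF assms(2)] by simp
qed

section \<open>The Hardy space as a vector space\<close>

lemma hardy2I:
  assumes "holomorphic_bidisc f" "\<And>z. z \<notin> bidisc \<Longrightarrow> f z = 0"
    and "(\<lambda>(i, j). (cmod (taylor_coeff f i j))\<^sup>2) summable_on UNIV"
  shows "f \<in> hardy2"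
  using assms by (simp add: hardy2_def)

lemma hardy2D:
  assumes "f \<in> hardy2"
  shows "holomorphic_bidisc f" "z \<notin> bidisc \<Longrightarrow> f z = 0"
    and "(\<lambda>(i, j). (cmod (taylor_coeff f i j))\<^sup>2) summable_on UNIV"
  using assms unfolding hardy2_def by blast+

lemma cmod_add_square_le: "(cmod (a + b))\<^sup>2 \<le> 2 * (cmod a)\<^sup>2 + 2 * (cmod b)\<^sup>2"
proof -
  have "(cmod (a + b))\<^sup>2 \<le> (cmod a + cmod b)\<^sup>2"
    by (intro power_mono norm_triangle_ineq norm_ge_zero)
  also have "\<dots> \<le> 2 * (cmod a)\<^sup>2 + 2 * (cmod b)\<^sup>2"
    using sum_squares_bound[of "cmod a" "cmod b"] by (simp add: power2_sum)
  finally show ?thesis .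
qed

text \<open>The square of the norm of a sum is estimated termwise with the constant \<open>2\<close>. This cruder form of the
  triangle inequality is sufficient for closures of subspaces to be subspaces.\<close>

lemma taylor_add_square_le:
  assumes "f \<in> hardy2" "g \<in> hardy2"
  shows "(case p of (i, j) \<Rightarrow> (cmod (taylor_coeff (\<lambda>z. f z + g z) i j))\<^sup>2)
    \<le> 2 * (case p of (i, j) \<Rightarrow> (cmod (taylor_coeff f i j))\<^sup>2)
     + 2 * (case p of (i, j) \<Rightarrow> (cmod (taylor_coeff g i j))\<^sup>2)"
  using cmod_add_square_le
  by (auto simp: taylor_coeff_add hardy2D(1) assms split: prod.split)

lemma hardy2_add:
  assumes "f \<in> hardy2" "g \<in> hardy2"
  shows "(\<lambda>z. f z + g z) \<in> hardy2"
    and "(hardy2_norm (\<lambda>z. f z + g z))\<^sup>2 \<le> 2 * (hardy2_norm f)\<^sup>2 + 2 * (hardy2_norm g)\<^sup>2"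
proof -
  let ?sq = "\<lambda>h p. case p of (i, j) \<Rightarrow> (cmod (taylor_coeff h i j))\<^sup>2"
  have s: "?sq f summable_on UNIV" "?sq g summable_on UNIV" using assms hardy2D(3) by auto
  then have s2: "(\<lambda>p. 2 * ?sq f p + 2 * ?sq g p) summable_on UNIV"
    by (intro summable_on_add summable_on_cmult_right)
  have s3: "?sq (\<lambda>z. f z + g z) summable_on UNIV"
    by (rule summable_on_comparison_test[OF s2]) (use taylor_add_square_le[OF assms] in \<open>auto split: prod.split\<close>)
  show "(\<lambda>z. f z + g z) \<in> hardy2"
    using assms s3 by (intro hardy2I holomorphic_bidisc_add) (simp_all only: hardy2D add_0_left not_False_eq_True)
  have "infsum (?sq (\<lambda>z. f z + g z)) UNIV \<le> infsum (\<lambda>p. 2 * ?sq f p + 2 * ?sq g p) UNIV"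
    by (rule infsum_mono[OF s3 s2 taylor_add_square_le[OF assms]])
  also have "\<dots> = 2 * infsum (?sq f) UNIV + 2 * infsum (?sq g) UNIV"
    using s by (subst infsum_add) (auto intro: summable_on_cmult_right simp: infsum_cmult_right')
  finally show "(hardy2_norm (\<lambda>z. f z + g z))\<^sup>2 \<le> 2 * (hardy2_norm f)\<^sup>2 + 2 * (hardy2_norm g)\<^sup>2"
    unfolding hardy2_norm_def by (subst (1 2 3) real_sqrt_pow2) (auto intro!: infsum_nonneg)
qed

lemma hardy2_cmult:
  assumes "f \<in> hardy2"
  shows "(\<lambda>z. c * f z) \<in> hardy2"
    and "hardy2_norm (\<lambda>z. c * f z) = cmod c * hardy2_norm f"
proof -
  let ?sq = "\<lambda>h p. case p of (i, j) \<Rightarrow> (cmod (taylor_coeff h i j))\<^sup>2"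
  have eq: "?sq (\<lambda>z. c * f z) = (\<lambda>p. (cmod c)\<^sup>2 * ?sq f p)"
    by (auto simp: taylor_coeff_cmult hardy2D(1)[OF assms] norm_mult power_mult_distrib)
  have "?sq (\<lambda>z. c * f z) summable_on UNIV"
    unfolding eq by (intro summable_on_cmult_right hardy2D(3) assms)
  then show "(\<lambda>z. c * f z) \<in> hardy2"
    using assms by (intro hardy2I holomorphic_bidisc_mult holomorphic_bidisc_const)
      (simp_all only: hardy2D mult_zero_right not_False_eq_True)
  show "hardy2_norm (\<lambda>z. c * f z) = cmod c * hardy2_norm f"
    unfolding hardy2_norm_def eq infsum_cmult_right' by (simp add: real_sqrt_mult)
qed

lemma hardy2_zero: "(\<lambda>_. 0) \<in> hardy2"
  by (rule hardy2I) (simp_all add: holomorphic_bidisc_const taylor_coeff_const split_def)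

lemma hardy2_norm_zero: "hardy2_norm (\<lambda>_. 0) = 0"
  by (simp add: hardy2_norm_def taylor_coeff_const split_def)

lemma hardy2_norm_nonneg: "0 \<le> hardy2_norm f"
  unfolding hardy2_norm_def by (auto intro!: infsum_nonneg)

lemma hardy2_diff:
  assumes "f \<in> hardy2" "g \<in> hardy2"
  shows "(\<lambda>z. f z - g z) \<in> hardy2"
  using hardy2_add(1)[OF assms(1) hardy2_cmult(1)[OF assms(2), of "-1"]] by simp

lemma cmod_taylor_coeff_le_norm:
  assumes "f \<in> hardy2"
  shows "cmod (taylor_coeff f i j) \<le> hardy2_norm f"
proof -
  have "sum (\<lambda>(i, j). (cmod (taylor_coeff f i j))\<^sup>2) {(i, j)}
      \<le> infsum (\<lambda>(i, j). (cmod (taylor_coeff f i j))\<^sup>2) UNIV"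
    by (rule finite_sum_le_infsum[OF hardy2D(3)[OF assms]]) auto
  then show ?thesis unfolding hardy2_norm_def by (intro real_le_rsqrt) simp
qed

text \<open>Elements of the Hardy space vanish off the bidisc by convention, hence the cut-off.\<close>

lemma hardy2_monomial:
  "(\<lambda>z. if z \<in> bidisc then fst z ^ a * snd z ^ b else 0) \<in> hardy2" (is "?m \<in> _")
  and taylor_coeff_hardy2_monomial:
  "taylor_coeff (\<lambda>z. if z \<in> bidisc then fst z ^ a * snd z ^ b else 0) i j = (if i = a \<and> j = b then 1 else 0)"
proof -
  have h: "holomorphic_bidisc (\<lambda>z. fst z ^ a * snd z ^ b)"
    by (intro holomorphic_bidisc_mult holomorphic_bidisc_power holomorphic_bidisc_fst holomorphic_bidisc_snd)
  show c: "taylor_coeff ?m i j = (if i = a \<and> j = b then 1 else 0)" for i j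
    using taylor_coeff_transform[OF h, of ?m] by (simp add: taylor_coeff_monomial)
  show "?m \<in> hardy2"
  proof (rule hardy2I)
    show "holomorphic_bidisc ?m" by (rule holomorphic_bidisc_transform[OF h]) simp
    have "(\<lambda>(i, j). (cmod (taylor_coeff ?m i j))\<^sup>2) summable_on {(a, b)}" by simp
    then show "(\<lambda>(i, j). (cmod (taylor_coeff ?m i j))\<^sup>2) summable_on UNIV"
      by (rule summable_on_cong_neutral[THEN iffD1, rotated -1])
        (simp_all add: c split_paired_all)
  qed auto
qed

lemma hardy2_vectorspace: "vectorspace class_ring hardy2_space"
proof -
  have "field (class_ring :: complex ring)" by (rule class_field)
  then show ?thesis
  proof (rule vs_criteria)
    show "\<forall>v\<in>carrier hardy2_space. \<exists>w\<in>carrier hardy2_space. v \<oplus>\<^bsub>hardy2_space\<^esub> w = \<zero>\<^bsub>hardy2_space\<^esub>"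
    proof
      fix v assume "v \<in> carrier hardy2_space"
      then have "v \<in> hardy2" by (simp add: hardy2_space_def)
      from hardy2_cmult(1)[OF this, of "-1"]
      show "\<exists>w\<in>carrier hardy2_space. v \<oplus>\<^bsub>hardy2_space\<^esub> w = \<zero>\<^bsub>hardy2_space\<^esub>"
        by (auto simp: hardy2_space_def intro!: bexI[of _ "\<lambda>z. -1 * v z"])
    qed
  qed (auto simp: hardy2_space_def hardy2_zero hardy2_add hardy2_cmult algebra_simps)
qed

lemma hardy2_closure_submodule:
  assumes S: "LinearCombinations.submodule class_ring S hardy2_space"
  shows "LinearCombinations.submodule class_ring (hardy2_closure S) hardy2_space"
proof -
  interpret V: vectorspace class_ring hardy2_space by (rule hardy2_vectorspace)
  interpret S: LinearCombinations.submodule class_ring S hardy2_space by (rule S)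
  have Sh: "S \<subseteq> hardy2" using S.subset by (simp add: hardy2_space_def)
  show ?thesis
  proof (rule LinearCombinations.submodule.intro)
    show "hardy2_closure S \<subseteq> carrier hardy2_space"
      by (auto simp: hardy2_closure_def hardy2_space_def)
    have "(\<lambda>_. 0) \<in> S" using S.zero_closed by (simp add: hardy2_space_def)
    then show "\<zero>\<^bsub>hardy2_space\<^esub> \<in> hardy2_closure S"
      by (auto simp: hardy2_closure_def hardy2_space_def hardy2_zero hardy2_norm_zero
          intro!: bexI[of _ "\<lambda>_. 0"])
    show "v \<oplus>\<^bsub>hardy2_space\<^esub> w \<in> hardy2_closure S"
      if v: "v \<in> hardy2_closure S" and w: "w \<in> hardy2_closure S" for v w
    proof -
      have vw: "v \<in> hardy2" "w \<in> hardy2" using v w by (auto simp: hardy2_closure_def)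
      have "\<exists>h\<in>S. hardy2_norm (\<lambda>z. (v z + w z) - h z) < e" if e: "e > 0" for e
      proof -
        have "e / 2 > 0" using e by simp
        then obtain g h where g: "g \<in> S" "hardy2_norm (\<lambda>z. v z - g z) < e / 2"
            and h: "h \<in> S" "hardy2_norm (\<lambda>z. w z - h z) < e / 2"
          using v w unfolding hardy2_closure_def by blast
        have d: "(\<lambda>z. v z - g z) \<in> hardy2" "(\<lambda>z. w z - h z) \<in> hardy2"
          using vw g h Sh by (auto intro!: hardy2_diff)
        have "(hardy2_norm (\<lambda>z. (v z + w z) - (g z + h z)))\<^sup>2
            = (hardy2_norm (\<lambda>z. (v z - g z) + (w z - h z)))\<^sup>2" by (simp add: algebra_simps)
        also have "\<dots> \<le> 2 * (hardy2_norm (\<lambda>z. v z - g z))\<^sup>2 + 2 * (hardy2_norm (\<lambda>z. w z - h z))\<^sup>2"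
          by (rule hardy2_add(2)[OF d])
        also have "\<dots> < 2 * (e / 2)\<^sup>2 + 2 * (e / 2)\<^sup>2"
          using g h hardy2_norm_nonneg by (intro add_strict_mono mult_strict_left_mono power_strict_mono) auto
        also have "\<dots> = e\<^sup>2" by (simp add: power2_eq_square)
        finally have "hardy2_norm (\<lambda>z. (v z + w z) - (g z + h z)) < e"
          using e by (intro power2_less_imp_less[of _ e]) auto
        moreover have "(\<lambda>z. g z + h z) \<in> S" using S.m_closed[OF g(1) h(1)] by (simp add: hardy2_space_def)
        ultimately show ?thesis by (rule rev_bexI[rotated])
      qed
      then show ?thesis using hardy2_add(1)[OF vw] by (simp add: hardy2_closure_def hardy2_space_def)
    qed
    show "c \<odot>\<^bsub>hardy2_space\<^esub> v \<in> hardy2_closure S" if v: "v \<in> hardy2_closure S" for c v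
    proof -
      have vh: "v \<in> hardy2" using v by (auto simp: hardy2_closure_def)
      have "\<exists>h\<in>S. hardy2_norm (\<lambda>z. c * v z - h z) < e" if e: "e > 0" for e
      proof -
        \<comment> \<open>Adding \<open>1\<close> to the denominator covers the case \<open>c = 0\<close>.\<close>
        have "e / (cmod c + 1) > 0" using e by (simp add: add_nonneg_pos)
        then obtain g where g: "g \<in> S" "hardy2_norm (\<lambda>z. v z - g z) < e / (cmod c + 1)"
          using v unfolding hardy2_closure_def by blast
        have d: "(\<lambda>z. v z - g z) \<in> hardy2" using vh g Sh by (auto intro!: hardy2_diff)
        have "hardy2_norm (\<lambda>z. c * v z - c * g z) = cmod c * hardy2_norm (\<lambda>z. v z - g z)"
          using hardy2_cmult(2)[OF d, of c] by (simp add: algebra_simps)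
        also have "\<dots> \<le> (cmod c + 1) * hardy2_norm (\<lambda>z. v z - g z)"
          using hardy2_norm_nonneg by (intro mult_right_mono) auto
        also have "\<dots> < e"
          using g(2) by (simp add: pos_less_divide_eq mult.commute add_nonneg_pos)
        finally have "hardy2_norm (\<lambda>z. c * v z - c * g z) < e" .
        moreover have "(\<lambda>z. c * g z) \<in> S" using S.smult_closed[OF _ g(1), of c] by (simp add: hardy2_space_def)
        ultimately show ?thesis by (rule rev_bexI[rotated])
      qed
      then show ?thesis using hardy2_cmult(1)[OF vh] by (simp add: hardy2_closure_def hardy2_space_def)
    qed
  qed (rule V.module_axioms)
qed

lemma span_orbit_submodule:
  assumes "\<forall>j\<in>{1..r}. f j \<in> D_infty \<phi>"
  shows "LinearCombinations.submodule class_ring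
    (LinearCombinations.module.span class_ring hardy2_space
       {(\<lambda>z. \<phi> z ^ n * f j z) | n j. j \<in> {1..r}}) hardy2_space"
proof -
  interpret V: vectorspace class_ring hardy2_space by (rule hardy2_vectorspace)
  show ?thesis using assms by (intro V.span_is_submodule) (auto simp: hardy2_space_def D_infty_def)
qed

section \<open>A lower bound for codimensions\<close>

text \<open>The type \<open>complex poly poly\<close> is viewed as a complex vector space; a scalar \<open>c\<close> acts as the
  constant polynomial \<open>[:c:]\<close> in \<open>x\<close>.\<close>

abbreviation scale_bipoly :: "complex \<Rightarrow> complex poly poly \<Rightarrow> complex poly poly" where
  "scale_bipoly \<equiv> \<lambda>c p. Polynomial.smult [:c:] p"

interpretation bipoly: vector_space scale_bipoly
proof
  show "Polynomial.smult [:a + b:] p = Polynomial.smult [:a:] p + Polynomial.smult [:b:] p"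
    for a b :: complex and p :: "complex poly poly"
    by (simp flip: smult_add_left)
qed (simp_all add: smult_add_right mult.commute flip: one_pCons)

text \<open>Two notions of submodule coexist: subgroups stable under scalars, and sets subject to closure
  conditions, the latter being the one for which spans are studied.\<close>

lemma submodule_LinearCombinations_imp_Module:
  assumes "LinearCombinations.submodule K W V"
  shows "Module.submodule W K V"
proof -
  interpret W: LinearCombinations.submodule K W V by fact
  interpret V: module K V by (rule W.module)
  show ?thesis
  proof (rule V.submoduleI)
    show "\<ominus>\<^bsub>V\<^esub> x \<in> W" if "x \<in> W" for x
      using that W.subset V.smult_minus_1[of x] W.smult_closed[of "\<ominus>\<^bsub>K\<^esub> \<one>\<^bsub>K\<^esub>" x]
      by (simp add: subset_iff)
  qed (use W.subset in auto)
qed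

lemma quot_space_simps:
  assumes "vectorspace K V" "Module.submodule W K V"
  shows "carrier (quot_space V W) = (\<lambda>v. W +>\<^bsub>V\<^esub> v) ` carrier V"
    and "\<And>v w. v \<in> carrier V \<Longrightarrow> w \<in> carrier V \<Longrightarrow>
      (W +>\<^bsub>V\<^esub> v) \<oplus>\<^bsub>quot_space V W\<^esub> (W +>\<^bsub>V\<^esub> w) = W +>\<^bsub>V\<^esub> (v \<oplus>\<^bsub>V\<^esub> w)"
    and "\<And>c v. c \<in> carrier K \<Longrightarrow> v \<in> carrier V \<Longrightarrow>
      c \<odot>\<^bsub>quot_space V W\<^esub> (W +>\<^bsub>V\<^esub> v) = W +>\<^bsub>V\<^esub> (c \<odot>\<^bsub>V\<^esub> v)"
proof -
  interpret vectorspace K V by fact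
  interpret W: Module.submodule W K V by fact
  have WV: "W \<subseteq> carrier V" using W.subset by simp
  have sub: "additive_subgroup W V"
    by (rule additive_subgroup.intro) (rule W.subgroup_axioms)
  interpret S: abelian_subgroup W V
    by (rule abelian_subgroupI3[OF sub M.abelian_group_axioms])
  show "carrier (quot_space V W) = (\<lambda>v. W +>\<^bsub>V\<^esub> v) ` carrier V"
    by (auto simp: quot_space_def A_RCOSETS_def')
  show "(W +>\<^bsub>V\<^esub> v) \<oplus>\<^bsub>quot_space V W\<^esub> (W +>\<^bsub>V\<^esub> w) = W +>\<^bsub>V\<^esub> (v \<oplus>\<^bsub>V\<^esub> w)"
    if "v \<in> carrier V" "w \<in> carrier V" for v w
    using that by (simp add: quot_space_def S.a_rcos_sum)
  show "c \<odot>\<^bsub>quot_space V W\<^esub> (W +>\<^bsub>V\<^esub> v) = W +>\<^bsub>V\<^esub> (c \<odot>\<^bsub>V\<^esub> v)"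
    if c: "c \<in> carrier K" and v: "v \<in> carrier V" for c v
  proof -
    have "W <+>\<^bsub>V\<^esub> (\<lambda>x. c \<odot>\<^bsub>V\<^esub> x) ` (W +>\<^bsub>V\<^esub> v) = W +>\<^bsub>V\<^esub> (c \<odot>\<^bsub>V\<^esub> v)"
    proof (intro equalityI subsetI)
      fix y assume "y \<in> W <+>\<^bsub>V\<^esub> (\<lambda>x. c \<odot>\<^bsub>V\<^esub> x) ` (W +>\<^bsub>V\<^esub> v)"
      then obtain w w' where w: "w \<in> W" "w' \<in> W" and y: "y = w \<oplus>\<^bsub>V\<^esub> c \<odot>\<^bsub>V\<^esub> (w' \<oplus>\<^bsub>V\<^esub> v)"
        unfolding set_add_def' a_r_coset_def' by auto
      have [simp]: "w \<in> carrier V" "w' \<in> carrier V" using w WV by auto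
      have "y = (w \<oplus>\<^bsub>V\<^esub> c \<odot>\<^bsub>V\<^esub> w') \<oplus>\<^bsub>V\<^esub> c \<odot>\<^bsub>V\<^esub> v"
        using c v y by (simp add: smult_r_distr M.a_assoc)
      moreover have "w \<oplus>\<^bsub>V\<^esub> c \<odot>\<^bsub>V\<^esub> w' \<in> W" using w c W.smult_closed S.a_closed by simp
      ultimately show "y \<in> W +>\<^bsub>V\<^esub> (c \<odot>\<^bsub>V\<^esub> v)" unfolding a_r_coset_def' by auto
    next
      fix y assume "y \<in> W +>\<^bsub>V\<^esub> (c \<odot>\<^bsub>V\<^esub> v)"
      then obtain w where w: "w \<in> W" and y: "y = w \<oplus>\<^bsub>V\<^esub> c \<odot>\<^bsub>V\<^esub> v"
        unfolding a_r_coset_def' by auto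
      have "v \<in> W +>\<^bsub>V\<^esub> v" using v by (simp add: S.a_rcos_self)
      with w y show "y \<in> W <+>\<^bsub>V\<^esub> (\<lambda>x. c \<odot>\<^bsub>V\<^esub> x) ` (W +>\<^bsub>V\<^esub> v)"
        unfolding set_add_def' by auto
    qed
    then show ?thesis by (simp add: quot_space_def)
  qed
qed

lemma coset_linear_map:
  assumes "vectorspace K V" "Module.submodule W K V"
  shows "linear_map K V (quot_space V W) (\<lambda>v. W +>\<^bsub>V\<^esub> v)"
proof -
  interpret V: vectorspace K V by fact
  interpret Q: vectorspace K "quot_space V W" by (rule quot_space_vectorspace[OF assms])
  show ?thesis
    by unfold_locales (auto simp: module_hom_def quot_space_simps[OF assms])
qed

text \<open>Lift a generating set of \<open>V / W\<close> with \<open>codim V W\<close> elements to \<open>V\<close>. Together with \<open>W\<close>, the lifts span \<open>V\<close>, so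
  that the image of \<open>V\<close> under \<open>L\<close> is contained in the span of \<open>B\<close> and the images of the lifts; an independent set in
  this image cannot be larger than the spanning set. To avoid manipulating linear combinations of
  cosets, the proof considers the set \<open>U\<close> of all cosets that \<open>L\<close> maps into this span, and shows that
  it is a submodule containing the generators.\<close>

lemma card_le_codim:
  fixes V :: "(complex, 'v, 'm) module_scheme" and L :: "'v \<Rightarrow> complex poly poly"
  assumes V: "vectorspace class_ring V" and W: "Module.submodule W class_ring V"
    and fin: "finite_codim V W"
    and L_add: "\<And>v w. v \<in> carrier V \<Longrightarrow> w \<in> carrier V \<Longrightarrow> L (v \<oplus>\<^bsub>V\<^esub> w) = L v + L w"
    and L_smult: "\<And>c v. v \<in> carrier V \<Longrightarrow> L (c \<odot>\<^bsub>V\<^esub> v) = scale_bipoly c (L v)"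
    and LW: "L ` W \<subseteq> bipoly.span B" and B: "finite B"
    and E: "bipoly.independent E" "E \<subseteq> L ` carrier V"
  shows "card E \<le> card B + codim V W"
proof -
  interpret V: vectorspace class_ring V by fact
  interpret Q: vectorspace class_ring "quot_space V W" by (rule quot_space_vectorspace[OF V W])
  let ?Q = "quot_space V W"
  note q = quot_space_simps[OF V W]
  interpret W: Module.submodule W class_ring V by fact
  have WV: "W \<subseteq> carrier V" using W.subset by simp
  have "\<exists>n A. finite A \<and> card A = n \<and> A \<subseteq> carrier ?Q \<and> Q.gen_set A"
    using fin unfolding finite_codim_def Q.fin_dim_def by blast
  from LeastI_ex[OF this] obtain A where A: "finite A" "card A = codim V W" "A \<subseteq> carrier ?Q"
      "Q.gen_set A"
    unfolding codim_def Q.dim_def by blast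
  from A(3) have "\<forall>X\<in>A. \<exists>v. v \<in> carrier V \<and> X = W +>\<^bsub>V\<^esub> v" by (auto simp: q)
  then obtain rep where rep: "\<And>X. X \<in> A \<Longrightarrow> rep X \<in> carrier V \<and> X = W +>\<^bsub>V\<^esub> rep X" by metis
  let ?S = "bipoly.span (B \<union> L ` rep ` A)"
  define U where "U = {X \<in> carrier ?Q. \<forall>v\<in>X. v \<in> carrier V \<and> L v \<in> ?S}"
  \<comment> \<open>Membership of a coset can be tested on one representative, since \<open>L\<close> maps \<open>W\<close> into the span.\<close>
  have coset_mem: "W +>\<^bsub>V\<^esub> v \<in> U \<longleftrightarrow> L v \<in> ?S" if v: "v \<in> carrier V" for v
  proof
    assume "W +>\<^bsub>V\<^esub> v \<in> U"
    moreover have "v \<in> W +>\<^bsub>V\<^esub> v"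
      using v W.one_closed unfolding a_r_coset_def' by (auto intro!: bexI[of _ "\<zero>\<^bsub>V\<^esub>"])
    ultimately show "L v \<in> ?S" by (auto simp: U_def)
  next
    assume "L v \<in> ?S"
    moreover have "L w \<in> ?S" if "w \<in> W" for w
      using LW that bipoly.span_mono[of B "B \<union> L ` rep ` A"] by blast
    ultimately show "W +>\<^bsub>V\<^esub> v \<in> U"
      using v WV by (auto simp: U_def q a_r_coset_def' L_add subset_iff intro: bipoly.span_add)
  qed
  have "LinearCombinations.submodule class_ring U ?Q"
  proof (rule LinearCombinations.submodule.intro)
    have zero: "\<zero>\<^bsub>?Q\<^esub> = W +>\<^bsub>V\<^esub> \<zero>\<^bsub>V\<^esub>"
      using WV by (simp add: quot_space_def V.M.a_coset_add_zero)
    have L0: "L \<zero>\<^bsub>V\<^esub> = 0" using L_add[of "\<zero>\<^bsub>V\<^esub>" "\<zero>\<^bsub>V\<^esub>"] by simp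
    show "\<zero>\<^bsub>?Q\<^esub> \<in> U" unfolding zero by (subst coset_mem) (auto simp: L0 bipoly.span_zero)
    show smult: "c \<odot>\<^bsub>?Q\<^esub> X \<in> U" if c: "c \<in> carrier class_ring" and X: "X \<in> U" for c X
    proof -
      obtain v where v: "v \<in> carrier V" "X = W +>\<^bsub>V\<^esub> v" using X by (auto simp: U_def q)
      have "L v \<in> ?S" using X v coset_mem by simp
      then show ?thesis using v by (simp add: q coset_mem L_smult bipoly.span_scale)
    qed
    show "X \<oplus>\<^bsub>?Q\<^esub> Y \<in> U" if XY: "X \<in> U" "Y \<in> U" for X Y
    proof -
      obtain v where v: "v \<in> carrier V" "X = W +>\<^bsub>V\<^esub> v" using XY by (auto simp: U_def q)
      obtain w where w: "w \<in> carrier V" "Y = W +>\<^bsub>V\<^esub> w" using XY by (auto simp: U_def q)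
      have "L v \<in> ?S" "L w \<in> ?S" using XY v w coset_mem by auto
      then show ?thesis using v w by (simp add: q coset_mem L_add bipoly.span_add)
    qed
  qed (auto simp: U_def Q.module_axioms)
  moreover have "A \<subseteq> U"
  proof
    fix X assume X: "X \<in> A"
    then have "L (rep X) \<in> ?S" by (intro bipoly.span_base) auto
    then show "X \<in> U" using rep[OF X] coset_mem[of "rep X"] by simp
  qed
  ultimately have "carrier ?Q \<subseteq> U" using Q.span_is_subset[of A U] A(4) by simp
  then have "L v \<in> ?S" if "v \<in> carrier V" for v
    using that coset_mem[OF that] by (auto simp: q)
  then have "E \<subseteq> ?S" using E(2) by auto
  then have "card E \<le> card (B \<union> L ` rep ` A)"
    using bipoly.independent_span_bound[of "B \<union> L ` rep ` A" E] E(1) B A(1) by auto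
  also have "\<dots> \<le> card B + card (L ` rep ` A)" by (rule card_Un_le)
  also have "card (L ` rep ` A) \<le> card A"
    using A(1) card_image_le le_trans finite_imageI by metis
  finally show ?thesis using A(2) by simp
qed

section \<open>Normal forms in the truncated algebra\<close>

text \<open>Linear functionals on polynomials, for the separation argument below.\<close>

interpretation bipoly_functional: vector_space_pair
    scale_bipoly "(*) :: complex \<Rightarrow> _"
  by unfold_locales (simp_all add: algebra_simps)

definition bipoly_of :: "nat \<Rightarrow> nat \<Rightarrow> (nat \<Rightarrow> nat \<Rightarrow> complex) \<Rightarrow> complex poly poly" where
  "bipoly_of M N a = (\<Sum>i<M. \<Sum>j<N. monom (monom (a i j) i) j)"

abbreviation bicoeff :: "complex poly poly \<Rightarrow> nat \<Rightarrow> nat \<Rightarrow> complex" where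
  "bicoeff p i j \<equiv> coeff (coeff p j) i"

text \<open>The representative modulo \<open>(x\<^sup>M, y\<^sup>N)\<close> in which only monomials outside the ideal occur.\<close>

definition trunc_poly :: "nat \<Rightarrow> nat \<Rightarrow> complex poly poly \<Rightarrow> complex poly poly" where
  "trunc_poly M N p = bipoly_of M N (bicoeff p)"

lemma bipoly_eqI: "(\<And>i j. bicoeff p i j = bicoeff q i j) \<Longrightarrow> p = q"
  by (simp add: poly_eq_iff)

lemma bicoeff_bipoly_of: "bicoeff (bipoly_of M N a) i j = (if i < M \<and> j < N then a i j else 0)"
proof -
  have "bicoeff (bipoly_of M N a) i j = (\<Sum>i'<M. \<Sum>j'<N. if j' = j then if i' = i then a i' j' else 0 else 0)"
    unfolding bipoly_of_def coeff_sum by (intro sum.cong refl) auto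
  also have "\<dots> = (\<Sum>i'<M. if i' = i then if j < N then a i' j else 0 else 0)"
    by (intro sum.cong refl) auto
  finally show ?thesis by simp
qed

lemma bicoeff_trunc_poly: "bicoeff (trunc_poly M N p) i j = (if i < M \<and> j < N then bicoeff p i j else 0)"
  by (simp add: trunc_poly_def bicoeff_bipoly_of)

lemma bicoeff_mult:
  "bicoeff (p * q) i j = (\<Sum>l\<le>j. \<Sum>k\<le>i. bicoeff p k l * bicoeff q (i - k) (j - l))"
  by (simp add: coeff_mult coeff_sum)

lemma trunc_poly_add: "trunc_poly M N (p + q) = trunc_poly M N p + trunc_poly M N q"
  by (rule bipoly_eqI) (simp add: bicoeff_trunc_poly)

lemma trunc_poly_scale: "trunc_poly M N (scale_bipoly c p) = scale_bipoly c (trunc_poly M N p)"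
  by (rule bipoly_eqI) (simp add: bicoeff_trunc_poly)

lemma trunc_poly_bipoly_of: "trunc_poly M N (bipoly_of M N a) = bipoly_of M N a"
  by (rule bipoly_eqI) (simp add: bicoeff_trunc_poly bicoeff_bipoly_of)

lemma trunc_poly_mult_cong:
  assumes "trunc_poly M N p = trunc_poly M N p'" "trunc_poly M N q = trunc_poly M N q'"
  shows "trunc_poly M N (p * q) = trunc_poly M N (p' * q')"
proof (rule bipoly_eqI)
  have e: "bicoeff p i j = bicoeff p' i j" "bicoeff q i j = bicoeff q' i j" if "i < M" "j < N" for i j
    using that assms by (metis bicoeff_trunc_poly)+
  show "bicoeff (trunc_poly M N (p * q)) i j = bicoeff (trunc_poly M N (p' * q')) i j" for i j
    unfolding bicoeff_trunc_poly bicoeff_mult using e by (auto intro!: sum.cong)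
qed

lemma trunc_poly_eq_0_iff: "trunc_poly M N p = 0 \<longleftrightarrow> (\<forall>i<M. \<forall>j<N. bicoeff p i j = 0)"
proof
  show "trunc_poly M N p = 0 \<Longrightarrow> \<forall>i<M. \<forall>j<N. bicoeff p i j = 0"
    using bicoeff_trunc_poly[of M N p] by (metis coeff_0)
  show "\<forall>i<M. \<forall>j<N. bicoeff p i j = 0 \<Longrightarrow> trunc_poly M N p = 0"
    by (rule bipoly_eqI) (simp add: bicoeff_trunc_poly)
qed

lemma ideal_trunc_ideal: "ideal (trunc_ideal M N) bipoly_ring"
  unfolding trunc_ideal_def by (rule ring.genideal_ideal[OF class_ring.ring_axioms]) auto

text \<open>The polynomials whose normal form vanishes are an ideal containing both generators. Conversely,
  each monomial of such a polynomial is a multiple of one of the generators.\<close>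

lemma mem_trunc_ideal_iff: "p \<in> trunc_ideal M N \<longleftrightarrow> trunc_poly M N p = 0"
proof
  let ?J = "{p. trunc_poly M N p = 0}"
  have z: "trunc_poly M N 0 = 0" by (rule bipoly_eqI) (simp add: bicoeff_trunc_poly)
  have "ideal ?J bipoly_ring"
  proof (rule idealI)
    show "subgroup ?J (add_monoid bipoly_ring)"
    proof (rule subgroup.intro)
      show "inv\<^bsub>add_monoid bipoly_ring\<^esub> p \<in> ?J" if "p \<in> ?J" for p
      proof -
        have "\<ominus>\<^bsub>bipoly_ring\<^esub> p = - p" by (simp add: class_ring_simps)
        then have "inv\<^bsub>add_monoid bipoly_ring\<^esub> p = - p" unfolding a_inv_def .
        then show ?thesis using that by (simp only: trunc_poly_eq_0_iff mem_Collect_eq) simp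
      qed
    qed (auto simp: z trunc_poly_add)
  qed (use trunc_poly_mult_cong[of M N _ 0] trunc_poly_mult_cong[of M N _ _ _ 0] in
      \<open>auto simp: z class_ring.ring_axioms\<close>)
  moreover have "{monom (monom 1 M) 0, monom (monom 1 0) N} \<subseteq> ?J"
    by (auto simp: trunc_poly_eq_0_iff)
  ultimately have "trunc_ideal M N \<subseteq> ?J"
    unfolding trunc_ideal_def by (rule ring.genideal_minimal[OF class_ring.ring_axioms])
  then show "p \<in> trunc_ideal M N \<Longrightarrow> trunc_poly M N p = 0" by blast
next
  assume p: "trunc_poly M N p = 0"
  let ?I = "trunc_ideal M N"
  interpret I: ideal ?I bipoly_ring by (rule ideal_trunc_ideal)
  have add: "a + b \<in> ?I" if "a \<in> ?I" "b \<in> ?I" for a b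
    using I.a_closed[OF that] by simp
  have zero: "0 \<in> ?I" using I.zero_closed by simp
  have mult: "a * b \<in> ?I" if "b \<in> ?I" for a b
    using I.I_l_closed[OF that, of a] by simp
  have sum: "sum g A \<in> ?I" if "\<And>x. x \<in> A \<Longrightarrow> g x \<in> ?I" for g and A :: "nat set"
    using that by (induction A rule: infinite_finite_induct) (auto intro: add zero)
  have gens: "monom (monom 1 M) 0 \<in> ?I" "monom (monom 1 0) N \<in> ?I"
    using ring.genideal_self[OF class_ring.ring_axioms, of "{monom (monom 1 M) 0, monom (monom 1 0) N}"]
    unfolding trunc_ideal_def by auto
  have mon: "monom (monom (bicoeff p i j) i) j \<in> ?I" for i j
  proof -
    consider "i < M" "j < N" | "M \<le> i" | "N \<le> j" by linarith
    then show ?thesis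
    proof cases
      case 1
      then show ?thesis using p zero by (simp add: trunc_poly_eq_0_iff)
    next
      case 2
      then have "monom (monom (bicoeff p i j) i) j
          = monom (monom (bicoeff p i j) (i - M)) j * monom (monom 1 M) 0"
        by (simp add: mult_monom)
      then show ?thesis using mult gens by simp
    next
      case 3
      then have "monom (monom (bicoeff p i j) i) j
          = monom (monom (bicoeff p i j) i) (j - N) * monom (monom 1 0) N"
        by (simp add: mult_monom)
      then show ?thesis using mult gens by simp
    qed
  qed
  have "p = (\<Sum>j\<le>degree p. monom (\<Sum>i\<le>degree (coeff p j). monom (bicoeff p i j) i) j)"
    by (simp add: poly_as_sum_of_monoms)
  also have "\<dots> = (\<Sum>j\<le>degree p. \<Sum>i\<le>degree (coeff p j). monom (monom (bicoeff p i j) i) j)"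
    by (intro sum.cong refl) (rule poly_eqI, simp add: coeff_sum)
  finally show "p \<in> ?I" using sum mon by (metis (no_types, lifting))
qed

abbreviation trunc_class :: "nat \<Rightarrow> nat \<Rightarrow> complex poly poly \<Rightarrow> complex poly poly set" where
  "trunc_class M N p \<equiv> trunc_ideal M N +>\<^bsub>bipoly_ring\<^esub> p"

lemma trunc_class_eq: "trunc_class M N p = {q. trunc_poly M N q = trunc_poly M N p}"
proof -
  have "q \<in> trunc_class M N p \<longleftrightarrow> trunc_poly M N q = trunc_poly M N p" for q
  proof -
    have "q \<in> trunc_class M N p \<longleftrightarrow> (\<exists>h\<in>trunc_ideal M N. q = h + p)"
      by (auto simp: a_r_coset_def')
    also have "\<dots> \<longleftrightarrow> q - p \<in> trunc_ideal M N"
      by (auto simp: algebra_simps intro!: bexI[of _ "q - p"])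
    also have "\<dots> \<longleftrightarrow> trunc_poly M N q = trunc_poly M N p"
      using trunc_poly_add[of M N "q - p" p] by (simp add: mem_trunc_ideal_iff)
    finally show ?thesis .
  qed
  then show ?thesis by blast
qed

lemma trunc_class_eq_iff: "trunc_class M N p = trunc_class M N q \<longleftrightarrow> trunc_poly M N p = trunc_poly M N q"
  by (auto simp: trunc_class_eq)

lemma trunc_alg_simps:
  "carrier (trunc_alg M N) = range (trunc_class M N)"
  "trunc_class M N p \<oplus>\<^bsub>trunc_alg M N\<^esub> trunc_class M N q = trunc_class M N (p + q)"
  "trunc_class M N p \<otimes>\<^bsub>trunc_alg M N\<^esub> trunc_class M N q = trunc_class M N (p * q)"
  "c \<odot>\<^bsub>trunc_alg M N\<^esub> trunc_class M N p = trunc_class M N (scale_bipoly c p)"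
  "\<one>\<^bsub>trunc_alg M N\<^esub> = trunc_class M N 1"
  "\<zero>\<^bsub>trunc_alg M N\<^esub> = trunc_class M N 0"
proof -
  let ?Q = "bipoly_ring Quot trunc_ideal M N"
  interpret h: ring_hom_ring bipoly_ring ?Q "trunc_class M N" by (rule ideal.rcos_ring_hom_ring[OF ideal_trunc_ideal])
  have c: "monom (monom c 0) 0 * p = scale_bipoly c p" for c p
    by (simp add: monom_0)
  note A = trunc_alg_def Let_def
  show "carrier (trunc_alg M N) = range (trunc_class M N)"
    by (auto simp: A FactRing_def A_RCOSETS_def')
  show "trunc_class M N p \<oplus>\<^bsub>trunc_alg M N\<^esub> trunc_class M N q = trunc_class M N (p + q)"
    using h.hom_add[of p q] by (simp add: A)
  show "trunc_class M N p \<otimes>\<^bsub>trunc_alg M N\<^esub> trunc_class M N q = trunc_class M N (p * q)"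
    using h.hom_mult[of p q] by (simp add: A)
  show "c \<odot>\<^bsub>trunc_alg M N\<^esub> trunc_class M N p = trunc_class M N (scale_bipoly c p)"
    using h.hom_mult[of "monom (monom c 0) 0" p] by (simp add: A c)
  show "\<one>\<^bsub>trunc_alg M N\<^esub> = trunc_class M N 1" using h.hom_one by (simp add: A)
  show "\<zero>\<^bsub>trunc_alg M N\<^esub> = trunc_class M N 0" using h.hom_zero by (simp add: A)
qed

lemma trunc_alg_minus:
  "trunc_class M N p \<ominus>\<^bsub>trunc_alg M N\<^esub> trunc_class M N q = trunc_class M N (p - q)"
proof -
  interpret A: algebra "class_ring :: complex ring" "trunc_alg M N" by (rule trunc_alg_algebra)
  have "\<ominus>\<^bsub>trunc_alg M N\<^esub> trunc_class M N q = trunc_class M N (- q)"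
    by (rule A.minus_equality) (auto simp: trunc_alg_simps)
  then show ?thesis by (simp add: a_minus_def trunc_alg_simps)
qed

lemma trunc_alg_pow: "trunc_class M N p [^]\<^bsub>trunc_alg M N\<^esub> (n::nat) = trunc_class M N (p ^ n)"
proof -
  interpret A: algebra "class_ring :: complex ring" "trunc_alg M N" by (rule trunc_alg_algebra)
  show ?thesis by (induction n) (simp_all add: trunc_alg_simps mult.commute)
qed

lemma trunc_alg_vectorspace: "vectorspace (class_ring :: complex ring) (trunc_alg M N)"
proof -
  interpret A: algebra "class_ring :: complex ring" "trunc_alg M N" by (rule trunc_alg_algebra)
  show ?thesis by (intro vectorspace.intro A.module_axioms class_field)
qed

lemma monom_eq_scale: "monom (monom (c :: complex) i) j = scale_bipoly c (monom (monom 1 i) j)"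
  by (simp add: smult_monom)

lemma trunc_alg_fin_dim: "vectorspace.fin_dim (class_ring :: complex ring) (trunc_alg M N)"
proof -
  interpret A: vectorspace "class_ring :: complex ring" "trunc_alg M N" by (rule trunc_alg_vectorspace)
  let ?G = "(\<lambda>(i, j). trunc_class M N (monom (monom 1 i) j)) ` ({..<M} \<times> {..<N})"
  have G: "?G \<subseteq> carrier (trunc_alg M N)" by (auto simp: trunc_alg_simps)
  interpret S: LinearCombinations.submodule class_ring "A.span ?G" "trunc_alg M N"
    by (rule A.span_is_submodule[OF G])
  have add: "trunc_class M N (p + q) \<in> A.span ?G"
    if "trunc_class M N p \<in> A.span ?G" "trunc_class M N q \<in> A.span ?G" for p q
    using S.m_closed[OF that] by (simp add: trunc_alg_simps)
  have zero: "trunc_class M N 0 \<in> A.span ?G" using S.zero_closed by (simp add: trunc_alg_simps)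
  have sum: "trunc_class M N (sum g X) \<in> A.span ?G"
    if "\<And>x. x \<in> X \<Longrightarrow> trunc_class M N (g x) \<in> A.span ?G" for g and X :: "nat set"
    using that by (induction X rule: infinite_finite_induct) (auto intro: add zero)
  have "trunc_class M N p \<in> A.span ?G" for p
  proof -
    have "trunc_class M N (monom (monom c i) j) \<in> A.span ?G" if "i < M" "j < N" for c i j
    proof -
      have "trunc_class M N (monom (monom 1 i) j) \<in> A.span ?G"
        using that by (intro subsetD[OF A.in_own_span[OF G]]) auto
      from S.smult_closed[OF _ this, of c] show ?thesis
        by (simp add: trunc_alg_simps smult_monom)
    qed
    then have "trunc_class M N (trunc_poly M N p) \<in> A.span ?G"
      unfolding trunc_poly_def bipoly_of_def by (intro sum) auto
    also have "trunc_class M N (trunc_poly M N p) = trunc_class M N p"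
      by (simp add: trunc_class_eq_iff trunc_poly_def trunc_poly_bipoly_of[unfolded trunc_poly_def])
    finally show ?thesis .
  qed
  then have "A.span ?G = carrier (trunc_alg M N)" using S.subset by (auto simp: trunc_alg_simps)
  then show ?thesis unfolding A.fin_dim_def using G by (intro exI[of _ ?G]) auto
qed

text \<open>The number \<open>codim\<close> carries information only if the quotient has finite dimension.\<close>

lemma trunc_alg_finite_codim:
  assumes "Module.submodule W class_ring (trunc_alg M N)"
  shows "finite_codim (trunc_alg M N) W"
proof -
  interpret T: linear_map class_ring "trunc_alg M N" "quot_space (trunc_alg M N) W" "(+>\<^bsub>trunc_alg M N\<^esub>) W"
    by (rule coset_linear_map[OF trunc_alg_vectorspace assms])
  show ?thesis
    unfolding finite_codim_def
    by (rule T.rank_nullity_main(2)[OF trunc_alg_fin_dim])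
      (simp add: quot_space_simps[OF trunc_alg_vectorspace assms])
qed

text \<open>A polynomial without constant term has order at least \<open>1\<close> at the origin, and orders add up
  in products.\<close>

lemma power_vanishing_order:
  assumes "bicoeff p 0 0 = 0" "i + j < n"
  shows "bicoeff (p ^ n) i j = 0"
  using assms(2)
proof (induction n arbitrary: i j)
  case (Suc n)
  have *: "bicoeff p k l * bicoeff (p ^ n) (i - k) (j - l) = 0" if "k \<le> i" "l \<le> j" for k l
  proof (cases "k = 0 \<and> l = 0")
    case False
    then have "(i - k) + (j - l) < n" using Suc.prems that by linarith
    then show ?thesis by (simp add: Suc.IH)
  qed (simp add: assms(1))
  show ?case unfolding power_Suc bicoeff_mult by (intro sum.neutral ballI *) auto
qed simp

text \<open>A subspace of a finite-dimensional space is closed, here for coefficientwise convergence. If \<open>v\<close> were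
  not in the span, some linear functional \<open>l\<close> would vanish on the span and map \<open>v\<close> to \<open>1\<close>. On
  normal forms, \<open>l\<close> is a fixed linear combination of finitely many coefficients, so it
  would be small on \<open>v - u\<close> for a close approximation \<open>u\<close>, although \<open>l (v - u) = 1\<close>.\<close>

lemma bipoly_span_limit:
  assumes lim: "\<And>e. e > 0 \<Longrightarrow> \<exists>u\<in>bipoly.span B. \<forall>i<M. \<forall>j<N. cmod (bicoeff v i j - bicoeff u i j) < e"
    and trunc: "\<And>u. u \<in> bipoly.span B \<Longrightarrow> trunc_poly M N u = u" "trunc_poly M N v = v"
  shows "v \<in> bipoly.span B"
proof (rule ccontr)
  assume v: "v \<notin> bipoly.span B"
  obtain B' where B': "B' \<subseteq> B" "bipoly.independent B'" "B \<subseteq> bipoly.span B'"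
    using bipoly.maximal_independent_subset by blast
  have span: "bipoly.span B' = bipoly.span B"
    using B' by (metis bipoly.span_mono bipoly.span_span subset_antisym)
  have "bipoly.independent (insert v B')"
    using B'(2) v span bipoly.independent_insertI by simp
  from bipoly_functional.linear_independent_extend[OF this, of "\<lambda>b. if b = v then 1 else 0"]
  obtain l where l: "Vector_Spaces.linear scale_bipoly (*) l"
    and lb: "\<forall>b\<in>insert v B'. l b = (if b = v then 1 else 0)" by blast
  interpret l: Vector_Spaces.linear scale_bipoly "(*)" l
    by (rule l)
  have vB: "v \<notin> B'" using v span bipoly.span_base by blast
  have l0: "l u = 0" if "u \<in> bipoly.span B" for u
    using that unfolding span[symmetric]
  proof (induction rule: bipoly.span_induct_alt)
    case (step c x y)
    then have "l x = 0" using lb vB by auto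
    with step show ?case by (simp add: l.add l.scale)
  qed (simp add: l.zero)
  define C where "C = (\<Sum>i<M. \<Sum>j<N. cmod (l (monom (monom 1 i) j)))"
  have C: "C \<ge> 0" unfolding C_def by (intro sum_nonneg) auto
  then obtain u where u: "u \<in> bipoly.span B" "\<forall>i<M. \<forall>j<N. cmod (bicoeff v i j - bicoeff u i j) < 1 / (C + 1)"
    using lim[of "1 / (C + 1)"] by auto
  have "v - u = trunc_poly M N (v - u)"
    by (rule bipoly_eqI) (metis bicoeff_trunc_poly trunc(2) trunc(1)[OF u(1)] coeff_diff diff_self)
  then have "l (v - u) = l (trunc_poly M N (v - u))" by simp
  also have "\<dots> = (\<Sum>i<M. \<Sum>j<N. bicoeff (v - u) i j * l (monom (monom 1 i) j))"
    unfolding trunc_poly_def bipoly_of_def l.sum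
    by (intro sum.cong refl) (subst monom_eq_scale, rule l.scale)
  finally have eq: "l (v - u) = \<dots>" .
  have "cmod (l (v - u)) \<le> (\<Sum>i<M. \<Sum>j<N. 1 / (C + 1) * cmod (l (monom (monom 1 i) j)))"
    unfolding eq
  proof (intro order.trans[OF norm_sum] sum_mono)
    fix i j assume "i \<in> {..<M}" "j \<in> {..<N}"
    then have "cmod (bicoeff (v - u) i j) \<le> 1 / (C + 1)" using u(2) by (simp add: less_imp_le)
    then show "cmod (bicoeff (v - u) i j * l (monom (monom 1 i) j)) \<le> 1 / (C + 1) * cmod (l (monom (monom 1 i) j))"
      unfolding norm_mult by (rule mult_right_mono) simp
  qed
  also have "\<dots> = C / (C + 1)" by (simp add: C_def sum_divide_distrib)
  also have "\<dots> < 1" using C by simp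
  also have "l (v - u) = 1" using l0[OF u(1)] lb by (simp add: l.diff)
  finally show False by simp
qed

text \<open>Each monomial has a coefficient that vanishes on the span of the other ones.\<close>

lemma independent_monomials:
  "bipoly.independent ((\<lambda>(i, j). monom (monom 1 i) j) ` ({..<M} \<times> {..<N}))"
    (is "bipoly.independent ?E")
  and card_monomials:
  "card ((\<lambda>(i, j). monom (monom 1 i) j :: complex poly poly) ` ({..<M} \<times> {..<N})) = M * N"
proof -
  have mc: "bicoeff (monom (monom 1 a) b) i j = (if i = a \<and> j = b then 1 else 0)" for a b i j by auto
  have inj: "inj (\<lambda>(i, j). monom (monom 1 i) j :: complex poly poly)"
    by (rule injI) (clarsimp, metis mc zero_neq_one)
  show "card ?E = M * N"
    by (subst card_image) (auto intro: inj_on_subset[OF inj])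
  have "\<exists>i j. bicoeff u i j \<noteq> 0 \<and> (\<forall>w\<in>?E - {u}. bicoeff w i j = 0)" if u: "u \<in> ?E" for u
  proof -
    obtain a b where ab: "u = monom (monom 1 a) b" using u by auto
    have "bicoeff w a b = 0" if "w \<in> ?E - {u}" for w
      using that unfolding ab by (auto simp: mc split: if_splits)
    then show ?thesis using mc[of a b a b] ab by (intro exI[of _ a] exI[of _ b]) simp
  qed
  moreover have "bicoeff w i j = 0" if "w \<in> bipoly.span S" "\<forall>w\<in>S. bicoeff w i j = 0" for w S i j
    using that by (induction rule: bipoly.span_induct_alt) auto
  ultimately show "bipoly.independent ?E" unfolding bipoly.dependent_def by blast
qed

section \<open>The image of the orbit space\<close>

definition taylor_poly :: "nat \<Rightarrow> nat \<Rightarrow> (complex \<times> complex \<Rightarrow> complex) \<Rightarrow> complex poly poly" where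
  "taylor_poly M N g = bipoly_of M N (taylor_coeff g)"

lemma taylor_trunc_eq: "taylor_trunc M N g = trunc_class M N (taylor_poly M N g)"
  by (simp add: taylor_trunc_def taylor_poly_def bipoly_of_def)

lemma bicoeff_taylor_poly: "bicoeff (taylor_poly M N g) i j = (if i < M \<and> j < N then taylor_coeff g i j else 0)"
  by (simp add: taylor_poly_def bicoeff_bipoly_of)

lemma trunc_poly_taylor_poly: "trunc_poly M N (taylor_poly M N g) = taylor_poly M N g"
  by (simp add: taylor_poly_def trunc_poly_bipoly_of)

lemma taylor_poly_add:
  assumes "holomorphic_bidisc f" "holomorphic_bidisc g"
  shows "taylor_poly M N (\<lambda>z. f z + g z) = taylor_poly M N f + taylor_poly M N g"
  by (rule bipoly_eqI) (simp add: bicoeff_taylor_poly taylor_coeff_add assms)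

lemma taylor_poly_cmult:
  assumes "holomorphic_bidisc f"
  shows "taylor_poly M N (\<lambda>z. c * f z) = scale_bipoly c (taylor_poly M N f)"
  by (rule bipoly_eqI) (simp add: bicoeff_taylor_poly taylor_coeff_cmult assms)

lemma taylor_poly_mult:
  assumes "holomorphic_bidisc f" "holomorphic_bidisc g"
  shows "taylor_poly M N (\<lambda>z. f z * g z) = trunc_poly M N (taylor_poly M N f * taylor_poly M N g)"
proof (rule bipoly_eqI)
  fix i j
  have "(\<Sum>l\<le>j. \<Sum>k\<le>i. taylor_coeff f k l * taylor_coeff g (i - k) (j - l))
      = bicoeff (taylor_poly M N f * taylor_poly M N g) i j" if "i < M" "j < N"
    unfolding bicoeff_mult using that by (intro sum.cong refl) (auto simp: bicoeff_taylor_poly)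
  then show "bicoeff (taylor_poly M N (\<lambda>z. f z * g z)) i j
      = bicoeff (trunc_poly M N (taylor_poly M N f * taylor_poly M N g)) i j"
    by (simp add: bicoeff_taylor_poly bicoeff_trunc_poly taylor_coeff_mult assms)
qed

lemma taylor_poly_power_mult:
  assumes \<phi>: "holomorphic_bidisc \<phi>" and g: "holomorphic_bidisc g"
  shows "taylor_poly M N (\<lambda>z. \<phi> z ^ n * g z) = trunc_poly M N (taylor_poly M N \<phi> ^ n * taylor_poly M N g)"
proof (induction n)
  case (Suc n)
  let ?h = "\<lambda>z. \<phi> z ^ n * g z"
  have "holomorphic_bidisc ?h"
    by (intro holomorphic_bidisc_mult holomorphic_bidisc_power \<phi> g)
  from taylor_poly_mult[OF \<phi> this, of M N]
  have "taylor_poly M N (\<lambda>z. \<phi> z ^ Suc n * g z) = trunc_poly M N (taylor_poly M N \<phi> * taylor_poly M N ?h)"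
    by (simp add: mult_ac)
  also have "\<dots> = trunc_poly M N (taylor_poly M N \<phi> * (taylor_poly M N \<phi> ^ n * taylor_poly M N g))"
    by (rule trunc_poly_mult_cong) (simp_all add: Suc trunc_poly_def trunc_poly_bipoly_of[unfolded trunc_poly_def])
  finally show ?case by (simp add: mult_ac)
qed (simp add: trunc_poly_taylor_poly)

text \<open>Normal forms of the generators \<open>P\<^sup>k q\<^sub>j\<close> with \<open>k < \<nu>\<close>, as in the Krylov spaces of the nilpotent
  operator of multiplication by \<open>P\<close>.\<close>

definition krylov :: "nat \<Rightarrow> nat \<Rightarrow> complex poly poly \<Rightarrow> nat \<Rightarrow> nat \<Rightarrow> (nat \<Rightarrow> complex poly poly) \<Rightarrow> complex poly poly set" where
  "krylov M N P \<nu> r q = (\<lambda>(k, j). trunc_poly M N (P ^ k * q j)) ` ({..<\<nu>} \<times> {1..r})"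

lemma card_krylov: "finite (krylov M N P \<nu> r q)" "card (krylov M N P \<nu> r q) \<le> r * \<nu>"
proof -
  show "finite (krylov M N P \<nu> r q)" by (simp add: krylov_def)
  have "card (krylov M N P \<nu> r q) \<le> card ({..<\<nu>} \<times> {1..r})"
    unfolding krylov_def by (rule card_image_le) simp
  then show "card (krylov M N P \<nu> r q) \<le> r * \<nu>" by (simp add: mult.commute)
qed

lemma trunc_poly_krylov:
  assumes "u \<in> bipoly.span (krylov M N P \<nu> r q)"
  shows "trunc_poly M N u = u"
  using assms
proof (induction rule: bipoly.span_induct_alt)
  case base
  show ?case by (rule bipoly_eqI) (simp add: bicoeff_trunc_poly)
next
  case (step c x y)
  then have "trunc_poly M N x = x"
    by (auto simp: krylov_def trunc_poly_def trunc_poly_bipoly_of[unfolded trunc_poly_def])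
  with step show ?case by (simp only: trunc_poly_add trunc_poly_scale)
qed

text \<open>Expanding \<open>(P + c)\<^sup>n\<close> gives a combination of powers of \<open>P\<close>, and those from \<open>P\<^sup>\<nu>\<close> on vanish. An induction
  on \<open>n\<close> with an additional factor \<open>P\<^sup>k\<close> replaces the binomial formula.\<close>

lemma translated_power_in_krylov_span:
  assumes P: "trunc_poly M N (P ^ \<nu>) = 0" and j: "j \<in> {1..r}"
  shows "trunc_poly M N ((P + [:[:c:]:]) ^ n * q j) \<in> bipoly.span (krylov M N P \<nu> r q)"
proof -
  let ?S = "bipoly.span (krylov M N P \<nu> r q)"
  have "trunc_poly M N ((P + [:[:c:]:]) ^ n * (P ^ k * q j)) \<in> ?S" for k
  proof (induction n arbitrary: k)
    case 0
    show ?case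
    proof (cases "k < \<nu>")
      case True
      then show ?thesis using j by (auto simp: krylov_def intro!: bipoly.span_base)
    next
      case False
      then have "P ^ k * q j = P ^ \<nu> * (P ^ (k - \<nu>) * q j)"
        by (simp flip: mult.assoc power_add)
      also have "trunc_poly M N \<dots> = trunc_poly M N (0 * (P ^ (k - \<nu>) * q j))"
        by (rule trunc_poly_mult_cong) (use P in \<open>auto simp: trunc_poly_eq_0_iff trunc_poly_eq_0_iff[THEN iffD2]\<close>)
      also have "\<dots> = 0" by (simp add: trunc_poly_eq_0_iff)
      finally show ?thesis by (simp add: bipoly.span_zero)
    qed
  next
    case (Suc n)
    have "(P + [:[:c:]:]) ^ Suc n * (P ^ k * q j) = (P + [:[:c:]:]) ^ n * (P ^ Suc k * q j)
        + scale_bipoly c ((P + [:[:c:]:]) ^ n * (P ^ k * q j))"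
      by (simp add: algebra_simps)
    then show ?case
      using Suc.IH[of k] Suc.IH[of "Suc k"]
      by (simp only: trunc_poly_add trunc_poly_scale bipoly.span_add bipoly.span_scale)
  qed
  from this[of 0] show ?thesis by simp
qed

lemma taylor_poly_span_orbit:
  assumes \<phi>: "holomorphic_bidisc \<phi>" and f: "\<forall>j\<in>{1..r}. f j \<in> D_infty \<phi>"
    and P: "taylor_poly M N \<phi> = P + [:[:c:]:]" "trunc_poly M N (P ^ \<nu>) = 0"
    and h: "h \<in> LinearCombinations.module.span class_ring hardy2_space
       {(\<lambda>z. \<phi> z ^ n * f j z) | n j. j \<in> {1..r}}" (is "h \<in> LinearCombinations.module.span _ _ ?G")
  shows "taylor_poly M N h \<in> bipoly.span (krylov M N P \<nu> r (\<lambda>j. taylor_poly M N (f j)))" (is "_ \<in> ?S")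
proof -
  interpret V: vectorspace class_ring hardy2_space by (rule hardy2_vectorspace)
  let ?U = "{h \<in> hardy2. taylor_poly M N h \<in> ?S}"
  have "LinearCombinations.submodule class_ring ?U hardy2_space"
  proof (rule LinearCombinations.submodule.intro)
    have "taylor_poly M N (\<lambda>_. 0) = 0"
      by (rule bipoly_eqI) (simp add: bicoeff_taylor_poly taylor_coeff_const)
    then show "\<zero>\<^bsub>hardy2_space\<^esub> \<in> ?U"
      by (simp add: hardy2_space_def hardy2_zero bipoly.span_zero)
  qed (auto simp: hardy2_space_def hardy2_add hardy2_cmult taylor_poly_add taylor_poly_cmult
        hardy2D(1) bipoly.span_add bipoly.span_scale V.module_axioms[unfolded hardy2_space_def])
  moreover have "?G \<subseteq> ?U"
  proof clarify
    fix n j assume j: "j \<in> {1..r}"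
    then have fj: "f j \<in> hardy2" "(\<lambda>z. \<phi> z ^ n * f j z) \<in> hardy2"
      using f by (auto simp: D_infty_def)
    then show "(\<lambda>z. \<phi> z ^ n * f j z) \<in> hardy2 \<and> taylor_poly M N (\<lambda>z. \<phi> z ^ n * f j z) \<in> ?S"
      unfolding taylor_poly_power_mult[OF \<phi> hardy2D(1)[OF fj(1)]] P(1)
      using translated_power_in_krylov_span[OF P(2) j] by simp
  qed
  ultimately have "V.span ?G \<subseteq> ?U" by (rule V.span_is_subset[rotated])
  then show ?thesis using h by blast
qed

text \<open>An element of the closure is approximated in norm, hence in each Taylor coefficient, by elements of the span
  of the orbit.\<close>

lemma taylor_poly_orbit_space:
  assumes \<phi>: "holomorphic_bidisc \<phi>" and f: "\<forall>j\<in>{1..r}. f j \<in> D_infty \<phi>"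
    and P: "taylor_poly M N \<phi> = P + [:[:c:]:]" "trunc_poly M N (P ^ \<nu>) = 0"
    and g: "g \<in> orbit_space \<phi> r f"
  shows "taylor_poly M N g \<in> bipoly.span (krylov M N P \<nu> r (\<lambda>j. taylor_poly M N (f j)))"
proof (rule bipoly_span_limit)
  fix e :: real assume "e > 0"
  then obtain h where h: "h \<in> LinearCombinations.module.span class_ring hardy2_space
       {(\<lambda>z. \<phi> z ^ n * f j z) | n j. j \<in> {1..r}}" "hardy2_norm (\<lambda>z. g z - h z) < e"
    using g unfolding orbit_space_def hardy2_closure_def by blast
  have hh: "h \<in> hardy2"
    using h(1) LinearCombinations.submodule.subset[OF span_orbit_submodule[OF f]] by (auto simp: hardy2_space_def)
  have gh: "g \<in> hardy2" using g by (simp add: orbit_space_def hardy2_closure_def)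
  have "cmod (taylor_coeff g i j - taylor_coeff h i j) < e" for i j
    using cmod_taylor_coeff_le_norm[OF hardy2_diff[OF gh hh], of i j] h(2)
    by (simp add: taylor_coeff_diff hardy2D(1) gh hh)
  then show "\<exists>u\<in>bipoly.span (krylov M N P \<nu> r (\<lambda>j. taylor_poly M N (f j))).
      \<forall>i<M. \<forall>j<N. cmod (bicoeff (taylor_poly M N g) i j - bicoeff u i j) < e"
    by (intro bexI[OF _ taylor_poly_span_orbit[OF \<phi> f P h(1)]]) (simp add: bicoeff_taylor_poly)
qed (rule trunc_poly_krylov trunc_poly_taylor_poly; assumption?)+

lemma orbit_space_submodule:
  assumes "\<forall>j\<in>{1..r}. f j \<in> D_infty \<phi>"
  shows "LinearCombinations.submodule class_ring (orbit_space \<phi> r f) hardy2_space"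
  unfolding orbit_space_def by (rule hardy2_closure_submodule[OF span_orbit_submodule[OF assms]])

text \<open>Without this, the quotient by the image would not be a vector space and its dimension would be
  meaningless.\<close>

lemma submodule_taylor_trunc_image:
  assumes "W \<subseteq> hardy2" "LinearCombinations.submodule class_ring W hardy2_space"
  shows "LinearCombinations.submodule class_ring (taylor_trunc M N ` W) (trunc_alg M N)"
proof -
  interpret A: vectorspace "class_ring :: complex ring" "trunc_alg M N" by (rule trunc_alg_vectorspace)
  interpret W: LinearCombinations.submodule class_ring W hardy2_space by fact
  have hol: "holomorphic_bidisc g" if "g \<in> W" for g using assms(1) that hardy2D(1) by blast
  show ?thesis
  proof (rule LinearCombinations.submodule.intro)
    show "taylor_trunc M N ` W \<subseteq> carrier (trunc_alg M N)"
      by (auto simp: trunc_alg_simps taylor_trunc_eq)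
    have "taylor_poly M N (\<lambda>_. 0) = 0"
      by (rule bipoly_eqI) (simp add: bicoeff_taylor_poly taylor_coeff_const)
    then show "\<zero>\<^bsub>trunc_alg M N\<^esub> \<in> taylor_trunc M N ` W"
      using W.zero_closed
      by (intro image_eqI[of _ _ "\<lambda>_. 0"]) (auto simp: hardy2_space_def trunc_alg_simps taylor_trunc_eq)
    show "v \<oplus>\<^bsub>trunc_alg M N\<^esub> w \<in> taylor_trunc M N ` W"
      if vw: "v \<in> taylor_trunc M N ` W" "w \<in> taylor_trunc M N ` W" for v w
    proof -
      obtain g h where gh: "g \<in> W" "h \<in> W" "v = taylor_trunc M N g" "w = taylor_trunc M N h"
        using vw by blast
      then show ?thesis using W.m_closed[of g h]
        by (intro image_eqI[of _ _ "\<lambda>z. g z + h z"])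
          (auto simp: hardy2_space_def trunc_alg_simps taylor_trunc_eq taylor_poly_add hol)
    qed
    show "c \<odot>\<^bsub>trunc_alg M N\<^esub> v \<in> taylor_trunc M N ` W" if v: "v \<in> taylor_trunc M N ` W" for c v
    proof -
      obtain g where g: "g \<in> W" "v = taylor_trunc M N g" using v by blast
      then show ?thesis using W.smult_closed[of c g]
        by (intro image_eqI[of _ _ "\<lambda>z. c * g z"])
          (auto simp: hardy2_space_def trunc_alg_simps taylor_trunc_eq taylor_poly_cmult hol)
    qed
  qed (rule A.module_axioms)
qed

text \<open>Here \<open>L\<close> maps a class to its normal form, which does not depend on the chosen representative.\<close>

lemma codim_trunc_alg_ge:
  assumes W: "Module.submodule W class_ring (trunc_alg M N)"
    and B: "finite B" "\<And>p. trunc_class M N p \<in> W \<Longrightarrow> trunc_poly M N p \<in> bipoly.span B"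
  shows "M * N \<le> card B + codim (trunc_alg M N) W"
proof -
  define L where "L X = trunc_poly M N (SOME p. p \<in> X)" for X
  have L: "L (trunc_class M N p) = trunc_poly M N p" for p
  proof -
    have "p \<in> trunc_class M N p" by (simp add: trunc_class_eq)
    then have "(SOME p'. p' \<in> trunc_class M N p) \<in> trunc_class M N p" by (rule someI)
    then show ?thesis unfolding L_def by (simp add: trunc_class_eq)
  qed
  let ?E = "(\<lambda>(i, j). monom (monom 1 i) j :: complex poly poly) ` ({..<M} \<times> {..<N})"
  have "card ?E \<le> card B + codim (trunc_alg M N) W"
  proof (rule card_le_codim[OF trunc_alg_vectorspace W trunc_alg_finite_codim[OF W], where L = L])
    interpret W: Module.submodule W class_ring "trunc_alg M N" by (rule W)
    have "W \<subseteq> range (trunc_class M N)" using W.subset by (simp add: trunc_alg_simps)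
    then show "L ` W \<subseteq> bipoly.span B" using B(2) by (auto simp: L)
    have "monom (monom 1 i) j \<in> L ` range (trunc_class M N)" if "i < M" "j < N" for i j
    proof (rule image_eqI)
      show "monom (monom 1 i) j = L (trunc_class M N (monom (monom 1 i) j))"
        unfolding L by (rule bipoly_eqI) (use that in \<open>auto simp: bicoeff_trunc_poly\<close>)
    qed simp
    then show "?E \<subseteq> L ` carrier (trunc_alg M N)" by (auto simp: trunc_alg_simps)
  qed (auto simp: trunc_alg_simps L trunc_poly_add trunc_poly_scale B independent_monomials)
  then show ?thesis by (simp add: card_monomials)
qed

lemma codim_hardy2_ge:
  assumes W: "Module.submodule W class_ring hardy2_space" and fin: "finite_codim hardy2_space W"
    and B: "finite B" "taylor_poly M N ` W \<subseteq> bipoly.span B"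
  shows "M * N \<le> card B + codim hardy2_space W"
proof -
  let ?E = "(\<lambda>(i, j). monom (monom 1 i) j :: complex poly poly) ` ({..<M} \<times> {..<N})"
  have "card ?E \<le> card B + codim hardy2_space W"
  proof (rule card_le_codim[OF hardy2_vectorspace W fin _ _ B(2) B(1)])
    have "monom (monom 1 i) j \<in> taylor_poly M N ` hardy2" if "i < M" "j < N" for i j
    proof (rule image_eqI)
      show "(\<lambda>z. if z \<in> bidisc then fst z ^ i * snd z ^ j else 0) \<in> hardy2" by (rule hardy2_monomial)
      show "monom (monom 1 i) j = taylor_poly M N (\<lambda>z. if z \<in> bidisc then fst z ^ i * snd z ^ j else 0)"
        by (rule bipoly_eqI) (use that in \<open>auto simp: bicoeff_taylor_poly taylor_coeff_hardy2_monomial\<close>)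
    qed
    then show "?E \<subseteq> taylor_poly M N ` carrier hardy2_space" by (auto simp: hardy2_space_def)
  qed (auto simp: hardy2_space_def taylor_poly_add taylor_poly_cmult hardy2D(1) independent_monomials)
  then show ?thesis by (simp add: card_monomials)
qed

theorem theorem3p2:
  fixes \<phi> :: "complex \<times> complex \<Rightarrow> complex"
    and r :: nat
    and f :: "nat \<Rightarrow> complex \<times> complex \<Rightarrow> complex"
  assumes "holomorphic_bidisc \<phi>"
    and "r \<ge> 1"
    and "\<forall>j\<in>{1..r}. f j \<in> D_infty \<phi>"
  shows "(\<forall>M N :: nat. M > 0 \<longrightarrow> N > 0 \<longrightarrow>
           (let A = trunc_alg M N;
                U = taylor_trunc M N \<phi> \<ominus>\<^bsub>A\<^esub> \<phi> (0, 0) \<odot>\<^bsub>A\<^esub> \<one>\<^bsub>A\<^esub>;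
                \<nu> = nilpotency_index A U
            in int (codim A (taylor_trunc M N ` orbit_space \<phi> r f))
                 \<ge> int M * int N - int r * int \<nu> \<and>
               int M * int N - int r * int \<nu>
                 \<ge> int M * int N - int r * (int M + int N - 1)))
       \<and> \<not> finite_codim hardy2_space (orbit_space \<phi> r f)"
proof -
  let ?W = "orbit_space \<phi> r f"
  define c where "c = \<phi> (0, 0)"
  define P where "P M N = taylor_poly M N \<phi> - [:[:c:]:]" for M N
  have TP: "taylor_poly M N \<phi> = P M N + [:[:c:]:]" for M N by (simp add: P_def)
  have P_nil: "trunc_poly M N (P M N ^ (M + N - 1)) = 0" if "M > 0" "N > 0" for M N
  proof -
    have "bicoeff (P M N) 0 0 = 0"
      using that by (simp add: P_def bicoeff_taylor_poly taylor_coeff_0_0 c_def)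
    from power_vanishing_order[OF this] show ?thesis
      unfolding trunc_poly_eq_0_iff by simp
  qed
  note krylov_span = taylor_poly_orbit_space[OF assms(1) assms(3) TP]
  have W: "LinearCombinations.submodule class_ring ?W hardy2_space"
    by (rule orbit_space_submodule[OF assms(3)])
  have Wh: "?W \<subseteq> hardy2" by (auto simp: orbit_space_def hardy2_closure_def)
  have fin: "int (codim (trunc_alg M N) (taylor_trunc M N ` ?W)) \<ge> int M * int N - int r * int \<nu> \<and>
      int M * int N - int r * int \<nu> \<ge> int M * int N - int r * (int M + int N - 1)"
    if MN: "M > 0" "N > 0"
      and \<nu>: "\<nu> = nilpotency_index (trunc_alg M N) (taylor_trunc M N \<phi> \<ominus>\<^bsub>trunc_alg M N\<^esub>
          \<phi> (0, 0) \<odot>\<^bsub>trunc_alg M N\<^esub> \<one>\<^bsub>trunc_alg M N\<^esub>)" for M N \<nu>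
  proof -
    have one: "scale_bipoly c 1 = [:[:c:]:]" by (simp add: one_pCons)
    have U: "taylor_trunc M N \<phi> \<ominus>\<^bsub>trunc_alg M N\<^esub> \<phi> (0, 0) \<odot>\<^bsub>trunc_alg M N\<^esub> \<one>\<^bsub>trunc_alg M N\<^esub>
        = trunc_class M N (P M N)"
      unfolding taylor_trunc_eq trunc_alg_simps trunc_alg_minus P_def c_def[symmetric] one ..
    have \<nu>': "\<nu> = (LEAST n. 0 < n \<and> trunc_poly M N (P M N ^ n) = 0)"
      unfolding \<nu> unfolding U
      unfolding nilpotency_index_def trunc_alg_pow trunc_alg_simps(6) trunc_class_eq_iff
      by (simp add: trunc_poly_eq_0_iff[THEN iffD2])
    have ex: "0 < M + N - 1 \<and> trunc_poly M N (P M N ^ (M + N - 1)) = 0" using P_nil MN by simp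
    have nil: "trunc_poly M N (P M N ^ \<nu>) = 0" unfolding \<nu>'
      using LeastI[where P = "\<lambda>n. 0 < n \<and> trunc_poly M N (P M N ^ n) = 0", OF ex] by simp
    have "\<nu> \<le> M + N - 1" unfolding \<nu>' by (rule Least_le) (rule ex)
    then have "int \<nu> \<le> int M + int N - 1" using MN by linarith
    then have le: "int r * int \<nu> \<le> int r * (int M + int N - 1)" by (intro mult_left_mono) auto
    let ?B = "krylov M N (P M N) \<nu> r (\<lambda>j. taylor_poly M N (f j))"
    have "M * N \<le> card ?B + codim (trunc_alg M N) (taylor_trunc M N ` ?W)"
    proof (rule codim_trunc_alg_ge)
      show "Module.submodule (taylor_trunc M N ` ?W) class_ring (trunc_alg M N)"
        by (intro submodule_LinearCombinations_imp_Module submodule_taylor_trunc_image Wh W)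
      show "trunc_poly M N p \<in> bipoly.span ?B"
        if p: "trunc_class M N p \<in> taylor_trunc M N ` ?W" for p
      proof -
        obtain g where "g \<in> ?W" "trunc_class M N p = trunc_class M N (taylor_poly M N g)"
          using p by (auto simp: taylor_trunc_eq)
        then show ?thesis
          using krylov_span[OF nil] by (simp add: trunc_class_eq_iff trunc_poly_taylor_poly)
      qed
    qed (rule card_krylov)
    also have "\<dots> \<le> r * \<nu> + codim (trunc_alg M N) (taylor_trunc M N ` ?W)"
      using card_krylov(2) by (rule add_right_mono)
    finally have "int M * int N \<le> int r * int \<nu> + int (codim (trunc_alg M N) (taylor_trunc M N ` ?W))"
      by (simp flip: of_nat_mult of_nat_add)
    then show ?thesis using le by simp
  qed
  moreover have "\<not> finite_codim hardy2_space ?W"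
  proof
    assume fc: "finite_codim hardy2_space ?W"
    define d where "d = codim hardy2_space ?W"
    \<comment> \<open>Any \<open>N\<close> with \<open>N\<^sup>2 > 2rN + dN\<close> contradicts the bound with \<open>M = N\<close>.\<close>
    define N where "N = 2 * r + d + 1"
    let ?B = "krylov N N (P N N) (N + N - 1) r (\<lambda>j. taylor_poly N N (f j))"
    have "N > 0" by (simp add: N_def)
    then have "N * N \<le> card ?B + d"
      unfolding d_def using krylov_span[OF P_nil]
      by (intro codim_hardy2_ge submodule_LinearCombinations_imp_Module W fc card_krylov) auto
    also have "\<dots> \<le> r * (N + N - 1) + d" using card_krylov(2) by (rule add_right_mono)
    also have "\<dots> \<le> r * (2 * N) + d * N"
      using \<open>N > 0\<close> by (intro add_mono mult_le_mono) auto
    also have "\<dots> < N * N" by (simp add: N_def algebra_simps)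
    finally show False by simp
  qed
  ultimately show ?thesis unfolding Let_def by blast
qed

end
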